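(* Let $\varepsilon>0$ be a small constant, $\alpha=\frac{\log 5}{\log 5+1-\varepsilon}$ and $\beta=\frac{\log 5-0.5\varepsilon}{\log 5+1-\varepsilon}$. Then for each large enough integer $n$, there exists an $n$-vertex graph $G=(V,E,c)$ with a terminal set $T$ of size $\frac{n}{2^{(\log n)^\alpha}}$, such that for any valid partition $\mathcal F$ of $V$ with $|\mathcal F|=O\!\left(\frac{n}{2^{(\log n)^\beta}}\right)$, there exists a demand $\mathcal D$ on the terminals with $\mathrm{cong}_G(\mathcal D)=\Omega\big((\log n)^{1-\alpha}\big)$ and $\mathrm{cong}_H(\mathcal D)=O(1)$, where $H$ is the contracted graph of $G$ with respect to $\mathcal F$.
   Context: All logarithms are base 2. Graphs are undirected with edge capacities $c(e)\ge 1$. A partition $\mathcal F$ of $V$ is valid if the terminals of $T$ lie in distinct parts. The contracted graph $H$ of $G$ with respect to $\mathcal F$ has one node per part of $\mathcal F$; for each edge $(u,v)$ of $G$ with $u,v$ in different parts there is an edge of the same capacity between their parts (parallel edges kept, self-loops removed); terminals are identified with the nodes containing them. A demand $\mathcal D$ on $T$ assigns $\mathcal D_{t,t'}\ge 0$ (not all zero) to each unordered terminal pair; a flow routes $\mathcal D$ if it sends $\mathcal D_{t,t'}$ units between $t,t'$; the congestion of a flow is $\max_e(\text{flow on }e)/c(e)$ and $\mathrm{cong}_G(\mathcal D)$ is the minimum congestion over flows routing $\mathcal D$ in $G$ (similarly for $H$). Asymptotic notation refers to $n\to\infty$ with constants independent of $n$. *)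

theory Defs
  imports Complex_Main "HOL-Library.Extended_Real"
begin

text \<open>A graph with edge index set E (edges are identified by indices, so parallel
  edges are possible), endpoint map ends and capacities cap.
  The input graph G is required to be a simple graph on vertex set V with
  capacities at least 1.\<close>

definition simple_cap_graph :: "'v::linorder set \<Rightarrow> 'e set \<Rightarrow> ('e \<Rightarrow> 'v \<times> 'v) \<Rightarrow> ('e \<Rightarrow> real) \<Rightarrow> bool" where
  "simple_cap_graph V E ends cap \<longleftrightarrow>
     finite V \<and> finite E \<and> inj_on ends E \<and>
     (\<forall>e\<in>E. fst (ends e) \<in> V \<and> snd (ends e) \<in> V \<and> fst (ends e) < snd (ends e) \<and> cap e \<ge> 1)"

definition valid_partition :: "'v set \<Rightarrow> 'v set \<Rightarrow> 'v set set \<Rightarrow> bool" where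
  "valid_partition V T F \<longleftrightarrow>
     (\<forall>P\<in>F. P \<noteq> {}) \<and> \<Union>F = V \<and>
     (\<forall>P\<in>F. \<forall>Q\<in>F. P \<noteq> Q \<longrightarrow> P \<inter> Q = {}) \<and>
     (\<forall>t\<in>T. \<forall>t'\<in>T. t \<noteq> t' \<longrightarrow> \<not> (\<exists>P\<in>F. t \<in> P \<and> t' \<in> P))"

definition part :: "'v set set \<Rightarrow> 'v \<Rightarrow> 'v set" where
  "part F x = (THE P. P \<in> F \<and> x \<in> P)"

text \<open>Contracted graph H: nodes are the parts, edges are the edges of G whose
  endpoints lie in different parts (parallel edges kept, self-loops removed),
  same capacities.\<close>
definition contr_edges :: "'v set set \<Rightarrow> 'e set \<Rightarrow> ('e \<Rightarrow> 'v \<times> 'v) \<Rightarrow> 'e set" where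
  "contr_edges F E ends = {e \<in> E. part F (fst (ends e)) \<noteq> part F (snd (ends e))}"

definition contr_ends :: "'v set set \<Rightarrow> ('e \<Rightarrow> 'v \<times> 'v) \<Rightarrow> 'e \<Rightarrow> 'v set \<times> 'v set" where
  "contr_ends F ends e = (part F (fst (ends e)), part F (snd (ends e)))"

text \<open>Demands on terminal set T: a symmetric nonnegative function on pairs of
  distinct terminals, not all zero. The unordered pair {t,t'} carries demand D t t'.\<close>
definition is_demand :: "'v set \<Rightarrow> ('v \<Rightarrow> 'v \<Rightarrow> real) \<Rightarrow> bool" where
  "is_demand T D \<longleftrightarrow>
     (\<forall>s t. D s t \<ge> 0 \<and> D s t = D t s \<and> (D s t \<noteq> 0 \<longrightarrow> s \<in> T \<and> t \<in> T \<and> s \<noteq> t)) \<and>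
     (\<exists>s t. D s t > 0)"

definition term_pairs :: "'v::linorder set \<Rightarrow> ('v \<times> 'v) set" where
  "term_pairs T = {(s,t). s \<in> T \<and> t \<in> T \<and> s < t}"

text \<open>A multicommodity flow g (signed flow on each undirected edge per commodity;
  positive = direction fst (ends e) to snd (ends e)) routes D in the graph
  (W, E, ends), where terminal t sits at node loc t: flow conservation
  for each commodity (s,t), sending D s t units from loc s to loc t.\<close>
definition routes :: "'w set \<Rightarrow> 'e set \<Rightarrow> ('e \<Rightarrow> 'w \<times> 'w) \<Rightarrow> ('v::linorder \<Rightarrow> 'w) \<Rightarrow> 'v set
     \<Rightarrow> ('v \<Rightarrow> 'v \<Rightarrow> real) \<Rightarrow> ('v \<times> 'v \<Rightarrow> 'e \<Rightarrow> real) \<Rightarrow> bool" where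
  "routes W E ends loc T D g \<longleftrightarrow>
     (\<forall>k\<in>term_pairs T. \<forall>x\<in>W.
        (\<Sum>e\<in>{e\<in>E. fst (ends e) = x}. g k e) - (\<Sum>e\<in>{e\<in>E. snd (ends e) = x}. g k e)
        = (if x = loc (fst k) then D (fst k) (snd k)
           else if x = loc (snd k) then - D (fst k) (snd k) else 0))"

text \<open>Minimum congestion of routing D (infinity if D cannot be routed).
  The load of edge e is the total amount of flow over all commodities on e.\<close>
definition cong :: "'w set \<Rightarrow> 'e set \<Rightarrow> ('e \<Rightarrow> 'w \<times> 'w) \<Rightarrow> ('e \<Rightarrow> real) \<Rightarrow> ('v::linorder \<Rightarrow> 'w)
     \<Rightarrow> 'v set \<Rightarrow> ('v \<Rightarrow> 'v \<Rightarrow> real) \<Rightarrow> ereal" where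
  "cong W E ends cap loc T D =
     Inf {ereal c | c. c \<ge> 0 \<and> (\<exists>g. routes W E ends loc T D g \<and>
            (\<forall>e\<in>E. (\<Sum>k\<in>term_pairs T. \<bar>g k e\<bar>) \<le> c * cap e))}"

end

theory Submission
  imports "HOL-Real_Asymp.Real_Asymp" Defs
begin

text \<open>
  Let \<open>X\<close> be a graph of degree at most \<open>d \<approx> log n\<close> and girth of order \<open>log n / log d\<close> on all \<open>n\<close> vertices,
  with as many edges as possible, so that almost all vertices have degree exactly \<open>d\<close>. The terminals form
  a net of radius \<open>2m \<approx> (log n)\<^sup>\<alpha> / log d\<close>. The graph \<open>G\<close> consists of \<open>X\<close> with capacities \<open>2m\<close> and
  of one edge of capacity \<open>d\<close> from each vertex to its terminal.

  By linear programming duality, if no demand between terminals that are far apart in \<open>X\<close> has small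
  congestion in \<open>H\<close> and large total value, then there are edge lengths of total volume \<open>Y\<close> for which each
  walk in \<open>H\<close> between such terminals is long compared with \<open>Y / (n d)\<close>. To refute this, discard the few vertices whose
  edge to the terminal is long. What remains of each part has small diameter, hence lies in a region
  where \<open>X\<close> looks like a tree. Let each remaining vertex jump inside its part to a vertex in a
  different branch at the centroid of the part; this can be done by a permutation of the part. Alternating such jumps, which
  are free in \<open>H\<close>, with steps along edges of \<open>X\<close> permutes the darts of \<open>X\<close>. Averaging over all starting
  darts therefore yields a trajectory of \<open>j\<close> steps of small total length. Since \<open>d\<close> is much larger than \<open>j\<close>, it
  can also be chosen such that no edge step points towards a centroid on either side, so it never
  backtracks. As the parts are large, nearly every jump covers a distance of order \<open>(log n)\<^sup>\<beta> / log d\<close>,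
  so the trajectory soon connects two vertices that are far apart in \<open>X\<close>.
\<close>


section \<open>Approximate packing-covering duality\<close>

lemma pos_part_sq_le: "(max 0 (x + h))\<^sup>2 \<le> (max 0 x + h)\<^sup>2" for x h :: real
proof -
  have "\<bar>max 0 (x + h)\<bar> \<le> \<bar>max 0 x + h\<bar>" by (auto simp: max_def abs_if)
  then show ?thesis by (rule abs_le_square_iff[THEN iffD1])
qed

text \<open>The squared excess of the loads over 1 is minimised over the simplex. A value at most 1
  makes every load at most 2. Otherwise the excesses at a near-minimiser serve as \<open>y\<close>:
  moving weight towards any \<open>i\<close> cannot lower the value much, which bounds the load of
  \<open>i\<close> under \<open>y\<close> from below. The slack between 1 and 2 lets a
  near-minimiser replace a minimiser.\<close>

lemma packing_covering_alternative:
  fixes A :: "'i \<Rightarrow> 'e \<Rightarrow> real"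
  assumes fin: "finite I" "finite E" and E0: "E \<noteq> {}"
  shows "(\<exists>w. (\<forall>i\<in>I. 0 \<le> w i) \<and> sum w I = 1 \<and> (\<forall>e\<in>E. (\<Sum>i\<in>I. w i * A i e) \<le> 2)) \<or>
         (\<exists>y. (\<forall>e\<in>E. 0 \<le> y e) \<and> 0 < sum y E \<and> (\<forall>i\<in>I. sum y E < (\<Sum>e\<in>E. y e * A i e)))"
proof (cases "I = {}")
  case True
  have "0 < sum (\<lambda>_. 1::real) E" using fin E0 by (simp add: card_gt_0_iff)
  then show ?thesis using True by (intro disjI2 exI[of _ "\<lambda>_. 1"]) auto
next
  case False
  define load where "load w e = (\<Sum>i\<in>I. w i * A i e)" for w e
  define \<Psi> where "\<Psi> w = (\<Sum>e\<in>E. (max 0 (load w e - 1))\<^sup>2)" for w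
  define S where "S = {w :: 'i \<Rightarrow> real. (\<forall>i\<in>I. 0 \<le> w i) \<and> sum w I = 1}"
  show ?thesis
  proof (cases "\<exists>w\<in>S. \<Psi> w \<le> 1")
    case True
    then obtain w where w: "w \<in> S" "\<Psi> w \<le> 1" by blast
    have "load w e \<le> 2" if "e \<in> E" for e
    proof -
      have "(max 0 (load w e - 1))\<^sup>2 \<le> \<Psi> w"
        unfolding \<Psi>_def using fin that by (intro member_le_sum) auto
      then have "(max 0 (load w e - 1))\<^sup>2 \<le> 1\<^sup>2" using w by simp
      then have "max 0 (load w e - 1) \<le> 1" by (rule power2_le_imp_le) simp
      then show ?thesis by simp
    qed
    then show ?thesis using w unfolding S_def load_def by blast
  next
    case no: False
    obtain i0 where i0: "i0 \<in> I" using False by blast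
    have unit: "(\<lambda>j. if j = i then 1 else 0) \<in> S" if "i \<in> I" for i
      using that fin by (auto simp: S_def)
    define \<mu> where "\<mu> = Inf (\<Psi> ` S)"
    have bdd: "bdd_below (\<Psi> ` S)"
      by (rule bdd_belowI[of _ 0]) (auto simp: \<Psi>_def intro: sum_nonneg)
    have ne: "\<Psi> ` S \<noteq> {}" using unit[OF i0] by blast
    have mu_le: "\<mu> \<le> \<Psi> w" if "w \<in> S" for w
      unfolding \<mu>_def using bdd that by (simp add: cINF_lower)
    define C where "C = (\<Sum>i\<in>I. \<Sum>e\<in>E. \<bar>A i e\<bar>)"
    have AC: "\<bar>A i e\<bar> \<le> C" if "i \<in> I" "e \<in> E" for i e
    proof -
      have "\<bar>A i e\<bar> \<le> (\<Sum>e\<in>E. \<bar>A i e\<bar>)" using fin that by (intro member_le_sum) auto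
      also have "\<dots> \<le> C" unfolding C_def using fin that
        by (intro member_le_sum[of i I "\<lambda>i. \<Sum>e\<in>E. \<bar>A i e\<bar>"]) (auto intro: sum_nonneg)
      finally show ?thesis .
    qed
    have C0: "0 \<le> C" unfolding C_def by (intro sum_nonneg) auto
    have loadC: "\<bar>load w e\<bar> \<le> C" if "w \<in> S" "e \<in> E" for w e
    proof -
      have "\<bar>load w e\<bar> \<le> (\<Sum>i\<in>I. \<bar>w i * A i e\<bar>)" unfolding load_def by (rule sum_abs)
      also have "\<dots> \<le> (\<Sum>i\<in>I. w i * C)"
        using that AC by (intro sum_mono) (auto simp: abs_mult S_def intro!: mult_mono)
      also have "\<dots> = C" using that by (simp add: S_def flip: sum_distrib_right)
      finally show ?thesis .
    qed
    define M where "M = card E * (2 * C)\<^sup>2"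
    have M0: "0 \<le> M" by (simp add: M_def)
    \<comment> \<open>Both the step size towards a vertex of the simplex and the tolerance of the
      near-minimiser. It is so small that the quadratic term \<open>t\<^sup>2 * M\<close> is at most
      \<open>t / 2\<close>.\<close>
    define t where "t = 1 / (2 * M + 2)"
    have t: "0 < t" "t \<le> 1" "t * M \<le> 1/2"
      unfolding t_def using M0 by (auto simp: field_simps)
    obtain w where w: "w \<in> S" "\<Psi> w < \<mu> + t"
      using cInf_lessD[OF ne, of "\<mu> + t"] t by (auto simp: \<mu>_def)
    define y where "y e = max 0 (load w e - 1)" for e
    have \<Psi>y: "\<Psi> w = (\<Sum>e\<in>E. (y e)\<^sup>2)" by (simp add: \<Psi>_def y_def)
    have \<Psi>1: "1 < \<Psi> w" using no w by force
    \<comment> \<open>Where \<open>y e\<close> is nonzero it equals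
      \<open>load w e - 1\<close>.\<close>
    have yload: "(\<Sum>e\<in>E. y e * load w e) = \<Psi> w + sum y E"
      unfolding \<Psi>y sum.distrib[symmetric]
      by (rule sum.cong) (auto simp: y_def max_def power2_eq_square algebra_simps)
    have main: "sum y E < (\<Sum>e\<in>E. y e * A i e)" if i: "i \<in> I" for i
    proof -
      define h where "h e = A i e - load w e" for e
      define w' where "w' j = (1 - t) * w j + t * (if j = i then 1 else 0)" for j
      have w'S: "w' \<in> S"
        using w t i fin unfolding S_def w'_def
        by (auto simp: sum.distrib sum_distrib_left[symmetric])
      have lw': "load w' e = load w e + t * h e" for e
      proof -
        have "load w' e = (\<Sum>j\<in>I. (1 - t) * (w j * A j e) + t * (if j = i then A i e else 0))"
          unfolding load_def w'_def by (rule sum.cong) (auto simp: algebra_simps)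
        also have "\<dots> = (1 - t) * load w e + t * A i e"
          using i fin by (simp add: sum.distrib load_def flip: sum_distrib_left)
        finally show ?thesis by (simp add: h_def algebra_simps)
      qed
      have "\<mu> \<le> \<Psi> w'" using mu_le w'S .
      also have "\<dots> \<le> (\<Sum>e\<in>E. (y e + t * h e)\<^sup>2)"
        unfolding \<Psi>_def y_def lw'
        by (intro sum_mono) (use pos_part_sq_le[of "load w _ - 1" "t * h _"] in \<open>simp add: algebra_simps\<close>)
      also have "\<dots> = \<Psi> w + 2 * t * (\<Sum>e\<in>E. y e * h e) + t\<^sup>2 * (\<Sum>e\<in>E. (h e)\<^sup>2)"
        unfolding \<Psi>y by (simp add: power2_sum sum.distrib sum_distrib_left power_mult_distrib algebra_simps)
      also have "(\<Sum>e\<in>E. (h e)\<^sup>2) \<le> M"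
      proof -
        have "(h e)\<^sup>2 \<le> (2 * C)\<^sup>2" if "e \<in> E" for e
        proof -
          have "\<bar>h e\<bar> \<le> \<bar>2 * C\<bar>" unfolding h_def using AC[OF i that] loadC[OF w(1) that] C0 by linarith
          then show ?thesis by (rule abs_le_square_iff[THEN iffD1])
        qed
        then show ?thesis unfolding M_def using sum_mono[of E "\<lambda>e. (h e)\<^sup>2" "\<lambda>_. (2*C)\<^sup>2"] by simp
      qed
      finally have "\<mu> \<le> \<Psi> w + 2 * t * (\<Sum>e\<in>E. y e * h e) + t\<^sup>2 * M"
        using t by (simp add: mult_left_mono)
      then have "0 < t + 2 * t * (\<Sum>e\<in>E. y e * h e) + t\<^sup>2 * M" using w by linarith
      also have "\<dots> = t * (1 + 2 * (\<Sum>e\<in>E. y e * h e) + t * M)"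
        by (simp add: algebra_simps power2_eq_square)
      finally have "0 < 1 + 2 * (\<Sum>e\<in>E. y e * h e) + t * M" using t by (simp add: zero_less_mult_iff)
      then have "-1 < (\<Sum>e\<in>E. y e * h e)" using t by linarith
      moreover have "(\<Sum>e\<in>E. y e * A i e) = (\<Sum>e\<in>E. y e * load w e) + (\<Sum>e\<in>E. y e * h e)"
        by (simp add: h_def sum.distrib[symmetric] algebra_simps)
      ultimately show ?thesis using yload \<Psi>1 by linarith
    qed
    have "0 < sum y E"
    proof (rule ccontr)
      assume "\<not> 0 < sum y E"
      moreover have "\<forall>e\<in>E. 0 \<le> y e" by (simp add: y_def)
      ultimately have "\<forall>e\<in>E. y e = 0" using fin
        by (metis less_le sum_nonneg sum_nonneg_eq_0_iff)
      then have "\<Psi> w = 0" unfolding \<Psi>y by simp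
      then show False using \<Psi>1 by simp
    qed
    then show ?thesis using main by (intro disjI2 exI[of _ y]) (auto simp: y_def)
  qed
qed

section \<open>Graphs of large girth\<close>

text \<open>A walk of length at most \<open>m\<close> that joins the ends of an edge without using
  it closes a cycle of length at most \<open>m + 1\<close>. Hence this says that the girth exceeds
  \<open>m + 1\<close>, without mentioning cycles.\<close>

definition girth_above :: "('a \<times> 'a) set \<Rightarrow> nat \<Rightarrow> bool" where
  "girth_above R m \<longleftrightarrow> (\<forall>u v k. (u, v) \<in> R \<longrightarrow> k \<le> m \<longrightarrow> (u, v) \<notin> (R - {(u, v), (v, u)}) ^^ k)"

lemma relpow_sym: "sym R \<Longrightarrow> sym (R ^^ k)"
proof (induction k)
  case (Suc k)
  then show ?case
    by (metis converse_relcomp relpow_commute relpow.simps(2) sym_conv_converse_eq)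
qed (simp add: sym_def)

text \<open>A walk can be shortened until it crosses the added edge at most once: when it crosses
  again, everything since it first stood at the end now reached can be cut out.\<close>

lemma relpow_insert_edge:
  assumes "(u, v) \<in> (S \<union> {(x, y), (y, x)}) ^^ m"
  shows "(\<exists>k\<le>m. (u, v) \<in> S ^^ k) \<or>
    (\<exists>k l. k + l < m \<and> ((u, x) \<in> S ^^ k \<and> (y, v) \<in> S ^^ l \<or> (u, y) \<in> S ^^ k \<and> (x, v) \<in> S ^^ l))"
  using assms
proof (induction m arbitrary: v)
  case 0
  then show ?case by auto
next
  case (Suc m)
  then obtain w where w: "(u, w) \<in> (S \<union> {(x, y), (y, x)}) ^^ m" "(w, v) \<in> S \<union> {(x, y), (y, x)}"
    by auto
  note extend = relpow_Suc_I[of _ _ _ S]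
  from Suc.IH[OF w(1)] show ?case
  proof (elim disjE exE conjE)
    fix k assume k: "k \<le> m" "(u, w) \<in> S ^^ k"
    consider "(w, v) \<in> S" | "w = x" "v = y" | "w = y" "v = x" using w(2) by auto
    then show ?thesis
    proof cases
      case 1
      then show ?thesis using k extend[OF k(2)] by (metis Suc_le_mono)
    next
      case 2
      then have "k + 0 < Suc m \<and> (u, x) \<in> S ^^ k \<and> (y, v) \<in> S ^^ 0" using k by simp
      then show ?thesis by blast
    next
      case 3
      then have "k + 0 < Suc m \<and> (u, y) \<in> S ^^ k \<and> (x, v) \<in> S ^^ 0" using k by simp
      then show ?thesis by blast
    qed
  next
    fix k l assume k: "k + l < m" "(u, x) \<in> S ^^ k" "(y, w) \<in> S ^^ l"
    consider "(w, v) \<in> S" | "w = x" "v = y" | "w = y" "v = x" using w(2) by auto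
    then show ?thesis
    proof cases
      case 1
      then have "k + Suc l < Suc m \<and> (u, x) \<in> S ^^ k \<and> (y, v) \<in> S ^^ Suc l"
        using k extend[OF k(3)] by simp
      then show ?thesis by blast
    next
      case 2
      then have "k + 0 < Suc m \<and> (u, x) \<in> S ^^ k \<and> (y, v) \<in> S ^^ 0" using k by simp
      then show ?thesis by blast
    next
      case 3
      then have "k \<le> Suc m \<and> (u, v) \<in> S ^^ k" using k by simp
      then show ?thesis by blast
    qed
  next
    fix k l assume k: "k + l < m" "(u, y) \<in> S ^^ k" "(x, w) \<in> S ^^ l"
    consider "(w, v) \<in> S" | "w = x" "v = y" | "w = y" "v = x" using w(2) by auto
    then show ?thesis
    proof cases
      case 1
      then have "k + Suc l < Suc m \<and> (u, y) \<in> S ^^ k \<and> (x, v) \<in> S ^^ Suc l"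
        using k extend[OF k(3)] by simp
      then show ?thesis by blast
    next
      case 3
      then have "k + 0 < Suc m \<and> (u, y) \<in> S ^^ k \<and> (x, v) \<in> S ^^ 0" using k by simp
      then show ?thesis by blast
    next
      case 2
      then have "k \<le> Suc m \<and> (u, v) \<in> S ^^ k" using k by simp
      then show ?thesis by blast
    qed
  qed
qed

lemma relpow_mono':
  fixes R S :: "('a \<times> 'a) set"
  shows "R \<subseteq> S \<Longrightarrow> (a, b) \<in> R ^^ k \<Longrightarrow> (a, b) \<in> S ^^ k"
proof (induction k arbitrary: b)
  case (Suc k)
  then obtain c where "(a, c) \<in> R ^^ k" "(c, b) \<in> R" by auto
  then show ?case using Suc.IH[OF Suc.prems(1)] Suc.prems(1) by auto
qed auto

text \<open>A short cycle through the new edge is a short walk from \<open>x\<close> to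
  \<open>y\<close>. A short cycle through an old edge and the new one also yields such a walk: go
  round the cycle the other way, across the old edge.\<close>

lemma girth_above_add_edge:
  assumes R: "sym R" "girth_above R m" and far: "\<And>k. k \<le> m \<Longrightarrow> (x, y) \<notin> R ^^ k"
  shows "girth_above (R \<union> {(x, y), (y, x)}) m"
  unfolding girth_above_def
proof (intro allI impI notI)
  fix u v k
  let ?R' = "R \<union> {(x, y), (y, x)}"
  let ?S = "R - {(u, v), (v, u)}"
  assume e: "(u, v) \<in> ?R'" and k: "k \<le> m" and walk: "(u, v) \<in> (?R' - {(u, v), (v, u)}) ^^ k"
  have farsym: "(y, x) \<notin> R ^^ k" if "k \<le> m" for k
    using far[OF that] relpow_sym[OF R(1)] by (metis symD)
  show False
  proof (cases "{(u, v), (v, u)} = {(x, y), (y, x)}")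
    case True
    then have "(u, v) \<in> R ^^ k" using walk by (auto elim: relpow_mono'[rotated])
    moreover have "(u, v) = (x, y) \<or> (u, v) = (y, x)" using True by auto
    ultimately show False using far[OF k] farsym[OF k] by auto
  next
    case False
    then have uv: "(u, v) \<in> R" using e by auto
    have symS: "sym ?S" using R(1) by (auto simp: sym_def)
    have "(u, v) \<in> (?S \<union> {(x, y), (y, x)}) ^^ k"
      using walk by (rule relpow_mono'[rotated]) auto
    from relpow_insert_edge[OF this] show False
    proof (elim disjE exE conjE)
      fix k' assume "k' \<le> k" "(u, v) \<in> ?S ^^ k'"
      then show False using R(2) uv k by (auto simp: girth_above_def)
    next
      fix a b assume ab: "a + b < k" "(u, x) \<in> ?S ^^ a" "(y, v) \<in> ?S ^^ b"
      have 1: "(x, u) \<in> R ^^ a" "(v, y) \<in> R ^^ b"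
        using relpow_mono'[of ?S R, OF _ symD[OF relpow_sym[OF symS] ab(2)]]
          relpow_mono'[of ?S R, OF _ symD[OF relpow_sym[OF symS] ab(3)]] by auto+
      have "(x, y) \<in> R ^^ (Suc a + b)"
        unfolding relpow_add using relpow_Suc_I[OF 1(1) uv] 1(2) by blast
      then show False using far[of "Suc a + b"] ab k by simp
    next
      fix a b assume ab: "a + b < k" "(u, y) \<in> ?S ^^ a" "(x, v) \<in> ?S ^^ b"
      have 1: "(y, u) \<in> R ^^ a" "(v, x) \<in> R ^^ b"
        using relpow_mono'[of ?S R, OF _ symD[OF relpow_sym[OF symS] ab(2)]]
          relpow_mono'[of ?S R, OF _ symD[OF relpow_sym[OF symS] ab(3)]] by auto+
      have "(y, x) \<in> R ^^ (Suc a + b)"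
        unfolding relpow_add using relpow_Suc_I[OF 1(1) uv] 1(2) by blast
      then show False using farsym[of "Suc a + b"] ab k by simp
    qed
  qed
qed

text \<open>A graph with as many edges as possible: two vertices of deficient degree must be close,
  since otherwise they could be joined.\<close>

lemma ex_maximal_girth_graph:
  fixes n d m :: nat
  assumes m: "1 \<le> m"
  shows "\<exists>R. R \<subseteq> {0..<n} \<times> {0..<n} \<and> sym R \<and> irrefl R \<and> (\<forall>u. card (R `` {u}) \<le> d) \<and> girth_above R m \<and>
    (\<forall>u v. u < n \<longrightarrow> v < n \<longrightarrow> card (R `` {u}) < d \<longrightarrow> card (R `` {v}) < d \<longrightarrow> (\<exists>k\<le>m. (u, v) \<in> R ^^ k))"
proof -
  define good where "good R \<longleftrightarrow> R \<subseteq> {0..<n} \<times> {0..<n} \<and> sym R \<and> irrefl R \<and>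
    (\<forall>u. card (R `` {u}) \<le> d) \<and> girth_above R m" for R
  have "finite {R. good R}"
    by (rule finite_subset[of _ "Pow ({0..<n} \<times> {0..<n})"]) (auto simp: good_def)
  moreover have "good {}" by (auto simp: good_def sym_def irrefl_def girth_above_def)
  ultimately obtain R where R: "good R" and max: "\<And>R'. good R' \<Longrightarrow> R \<subseteq> R' \<Longrightarrow> R = R'"
    using finite_has_maximal[of "{R. good R}"] by blast
  have fin: "finite R" using R finite_subset by (auto simp: good_def)
  have "\<exists>k\<le>m. (u, v) \<in> R ^^ k"
    if uv: "u < n" "v < n" "card (R `` {u}) < d" "card (R `` {v}) < d" for u v
  proof (rule ccontr)
    assume no: "\<not> (\<exists>k\<le>m. (u, v) \<in> R ^^ k)"
    let ?R' = "R \<union> {(u, v), (v, u)}"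
    have ne: "u \<noteq> v" using no by (metis le0 pair_in_Id_conv relpow.simps(1))
    have "card (?R' `` {w}) \<le> d" for w
    proof -
      consider "w = u" | "w = v" | "w \<noteq> u" "w \<noteq> v" by blast
      then show ?thesis
      proof cases
        case 1
        then have "?R' `` {w} = insert v (R `` {u})" using ne by auto
        then show ?thesis using uv
          by (metis Suc_leI card_insert_if fin finite_Image le_trans less_imp_le_nat)
      next
        case 2
        then have "?R' `` {w} = insert u (R `` {v})" using ne by auto
        then show ?thesis using uv
          by (metis Suc_leI card_insert_if fin finite_Image le_trans less_imp_le_nat)
      next
        case 3
        then have "?R' `` {w} = R `` {w}" by auto
        then show ?thesis using R by (simp add: good_def)
      qed
    qed
    moreover have "girth_above ?R' m"
      using R no by (intro girth_above_add_edge) (auto simp: good_def)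
    ultimately have "good ?R'"
      using R uv ne by (auto simp: good_def sym_def irrefl_def)
    from max[OF this] have "(u, v) \<in> R" by auto
    then have "(u, v) \<in> R ^^ 1" by auto
    then show False using no m by blast
  qed
  then show ?thesis using R unfolding good_def by blast
qed

section \<open>Balls, truncated distances and directions\<close>

lemma card_relpow_ball:
  fixes R :: "('a \<times> 'a) set"
  assumes fin: "finite R" and deg: "\<And>u. card (R `` {u}) \<le> d"
  shows "finite {v. \<exists>k\<le>m. (u, v) \<in> R ^^ k} \<and> card {v. \<exists>k\<le>m. (u, v) \<in> R ^^ k} \<le> (d + 1) ^ m"
proof (induction m)
  case 0
  have "{v. \<exists>k\<le>0. (u, v) \<in> R ^^ k} = {u}" by auto
  then show ?case by simp
next
  case (Suc m)
  let ?B = "\<lambda>m. {v. \<exists>k\<le>m. (u, v) \<in> R ^^ k}"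
  have sub: "?B (Suc m) \<subseteq> ?B m \<union> (\<Union>w\<in>?B m. R `` {w})"
  proof
    fix v assume "v \<in> ?B (Suc m)"
    then obtain k where k: "k \<le> Suc m" "(u, v) \<in> R ^^ k" by blast
    show "v \<in> ?B m \<union> (\<Union>w\<in>?B m. R `` {w})"
    proof (cases "k \<le> m")
      case True
      then show ?thesis using k by blast
    next
      case False
      then have "(u, v) \<in> R ^^ Suc m" using k by (simp add: le_Suc_eq)
      then obtain w where "(u, w) \<in> R ^^ m" "(w, v) \<in> R" by auto
      then show ?thesis by blast
    qed
  qed
  have finU: "finite (?B m \<union> (\<Union>w\<in>?B m. R `` {w}))" using Suc fin by simp
  have "card (?B (Suc m)) \<le> card (?B m \<union> (\<Union>w\<in>?B m. R `` {w}))"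
    by (rule card_mono[OF finU sub])
  also have "\<dots> \<le> card (?B m) + card (\<Union>w\<in>?B m. R `` {w})" by (rule card_Un_le)
  also have "card (\<Union>w\<in>?B m. R `` {w}) \<le> (\<Sum>w\<in>?B m. card (R `` {w}))"
    using Suc by (intro card_UN_le) simp
  also have "\<dots> \<le> (\<Sum>w\<in>?B m. d)" by (intro sum_mono deg)
  finally have "card (?B (Suc m)) \<le> (d + 1) * card (?B m)" by (simp add: mult.commute)
  also have "\<dots> \<le> (d + 1) * (d + 1) ^ m" using Suc by (intro mult_le_mono2) simp
  finally show ?case using finite_subset[OF sub finU] by simp
qed

text \<open>Two walks of length at most \<open>r\<close> and one more edge have total length at most
  \<open>2 * r + 1\<close>, so this girth makes the graph look like a tree within distance
  \<open>r\<close>.\<close>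

locale high_girth_graph =
  fixes n d r :: nat and R :: "(nat \<times> nat) set"
  assumes R_sub: "R \<subseteq> {0..<n} \<times> {0..<n}" and symR: "sym R" and irr: "irrefl R"
    and deg: "card (R `` {u}) \<le> d" and girth: "girth_above R (2 * r + 1)"
begin

lemma finR: "finite R" using R_sub finite_subset by blast

lemma R_sym: "(u, v) \<in> R \<Longrightarrow> (v, u) \<in> R" using symR by (rule symD)

lemma R_less: "(u, v) \<in> R \<Longrightarrow> u < n \<and> v < n" using R_sub by auto

lemma R_neq: "(u, v) \<in> R \<Longrightarrow> u \<noteq> v" using irr by (auto simp: irrefl_def)

text \<open>The truncation makes this a metric even if the graph is disconnected. A value of \<open>r + 1\<close>
  only means that the distance exceeds \<open>r\<close>.\<close>

definition dd :: "nat \<Rightarrow> nat \<Rightarrow> nat" where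
  "dd u v = (LEAST k. k = r + 1 \<or> (u, v) \<in> R ^^ k)"

lemma dd_le: "dd u v \<le> r + 1"
  unfolding dd_def by (rule Least_le) simp

lemma dd_leI: "(u, v) \<in> R ^^ k \<Longrightarrow> dd u v \<le> k"
  unfolding dd_def by (rule Least_le) simp

lemma dd_walk: "dd u v \<le> r \<Longrightarrow> (u, v) \<in> R ^^ dd u v"
  using LeastI[of "\<lambda>k. k = r + 1 \<or> (u, v) \<in> R ^^ k" "r + 1"] unfolding dd_def by auto

lemma dd_sym: "dd u v = dd v u"
  using relpow_sym[OF symR] unfolding dd_def by (metis symD)

lemma dd_self [simp]: "dd u u = 0"
  using dd_leI[of u u 0] by simp

lemma dd_eq_0 [simp]: "dd u v = 0 \<longleftrightarrow> u = v"
  using dd_walk[of u v] by auto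

lemma dd_triangle: "dd u w \<le> dd u v + dd v w"
proof (cases "dd u v \<le> r \<and> dd v w \<le> r")
  case True
  then have "(u, w) \<in> R ^^ (dd u v + dd v w)"
    unfolding relpow_add using dd_walk by blast
  then show ?thesis by (rule dd_leI)
next
  case False
  then show ?thesis using dd_le[of u w] by linarith
qed

lemma dd_edge: "(u, v) \<in> R \<Longrightarrow> dd u v = 1"
  using dd_leI[of u v 1] R_neq dd_eq_0[of u v] by fastforce

lemma dd_edge_le: "(u, x) \<in> R \<Longrightarrow> dd x v \<le> dd u v + 1" "(u, x) \<in> R \<Longrightarrow> dd u v \<le> dd x v + 1"
  using dd_triangle[of x v u] dd_triangle[of u v x] dd_edge[of u x] dd_sym[of u x] by auto

lemma dd_less_n: "dd u v \<le> r \<Longrightarrow> u < n \<Longrightarrow> v < n"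
proof -
  assume "dd u v \<le> r" "u < n"
  then have "(u, v) \<in> R ^^ dd u v" by (rule_tac dd_walk)
  moreover have "(u, v) \<in> R ^^ k \<Longrightarrow> v < n" for k
    using \<open>u < n\<close> R_less by (cases k) auto
  ultimately show ?thesis by blast
qed

lemma card_ball: "finite {v. dd u v \<le> m} \<and> card {v. dd u v \<le> m} \<le> (d + 1) ^ m" if "m \<le> r"
proof -
  have eq: "{v. dd u v \<le> m} = {v. \<exists>k\<le>m. (u, v) \<in> R ^^ k}"
    using dd_walk[of u] dd_leI[of u] that by (fastforce intro: order_trans)
  show ?thesis unfolding eq by (rule card_relpow_ball[OF finR deg])
qed

text \<open>The walk never visits \<open>u\<close>, as its remainder from there would be too short
  to reach \<open>v\<close>. So it avoids all edges at \<open>u\<close>.\<close>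

lemma walk_avoid:
  assumes "x \<noteq> u" "(x, v) \<in> R ^^ p" "\<And>q. q < p \<Longrightarrow> (u, v) \<notin> R ^^ q"
  shows "(x, v) \<in> (R - {(u, w), (w, u)}) ^^ p"
  using assms
proof (induction p arbitrary: x)
  case (Suc p)
  then obtain z where z: "(x, z) \<in> R" "(z, v) \<in> R ^^ p" using relpow_Suc_D2 by metis
  then have "z \<noteq> u" using Suc.prems(3)[of p] by auto
  then have "(z, v) \<in> (R - {(u, w), (w, u)}) ^^ p" using Suc z by auto
  moreover have "(x, z) \<in> R - {(u, w), (w, u)}" using z Suc.prems(1) \<open>z \<noteq> u\<close> by auto
  ultimately show ?case by (rule relpow_Suc_I2[rotated])
qed auto

text \<open>If two neighbours of \<open>u\<close> were at least as close to \<open>v\<close> as \<open>u\<close> is, then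
  the walk from one of them to the other via \<open>v\<close> would close a short cycle.\<close>

lemma unique_nearer:
  assumes x: "(u, x) \<in> R" "(u, x') \<in> R" and uv: "dd u v \<le> r"
    and le: "dd x v \<le> dd u v" "dd x' v \<le> dd u v"
  shows "x = x'"
proof (rule ccontr)
  assume ne: "x \<noteq> x'"
  let ?S = "R - {(u, x), (x, u)}"
  have no: "(u, v) \<notin> R ^^ q" if "q < dd u v" for q
    using that dd_leI[of u v q] by auto
  have 1: "(x, v) \<in> ?S ^^ dd x v"
    using R_neq[OF x(1)] dd_walk[of x v] uv le no by (intro walk_avoid) auto
  have 2: "(x', v) \<in> ?S ^^ dd x' v"
    using R_neq[OF x(2)] dd_walk[of x' v] uv le no by (intro walk_avoid) auto
  have symS: "sym ?S" using symR by (auto simp: sym_def)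
  have "(v, x') \<in> ?S ^^ dd x' v" using symD[OF relpow_sym[OF symS] 2] .
  moreover have "(x', u) \<in> ?S" using R_sym[OF x(2)] ne R_neq[OF x(2)] by auto
  ultimately have "(x, u) \<in> ?S ^^ (dd x v + Suc (dd x' v))"
    unfolding relpow_add using 1 by auto
  then have "(u, x) \<in> ?S ^^ (dd x v + Suc (dd x' v))" using symD[OF relpow_sym[OF symS]] by blast
  moreover have "dd x v + Suc (dd x' v) \<le> 2 * r + 1" using le uv by linarith
  ultimately show False using girth x(1) unfolding girth_above_def by blast
qed

text \<open>The first step of the geodesic from \<open>u\<close> to \<open>v\<close>. The choice is
  meaningful, and unique by \<open>unique_nearer\<close>, if \<open>u \<noteq> v\<close> and
  \<open>dd u v \<le> r\<close>.\<close>

definition dir :: "nat \<Rightarrow> nat \<Rightarrow> nat" where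
  "dir u v = (SOME x. (u, x) \<in> R \<and> dd x v < dd u v)"

lemma dir: "(u, dir u v) \<in> R" "dd u v = Suc (dd (dir u v) v)"
  if uv: "u \<noteq> v" "dd u v \<le> r"
proof -
  obtain k where k: "dd u v = Suc k" using uv(1) dd_eq_0 not0_implies_Suc by blast
  then have "(u, v) \<in> R ^^ Suc k" using dd_walk[OF uv(2)] by simp
  then obtain x where "(u, x) \<in> R" "(x, v) \<in> R ^^ k" using relpow_Suc_D2 by metis
  then have "\<exists>x. (u, x) \<in> R \<and> dd x v < dd u v" using k dd_leI[of x v k] by auto
  from someI_ex[OF this] have *: "(u, dir u v) \<in> R" "dd (dir u v) v < dd u v"
    unfolding dir_def by auto
  show "(u, dir u v) \<in> R" by fact
  show "dd u v = Suc (dd (dir u v) v)" using * dd_edge_le[OF *(1), of v] by linarith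
qed

lemma dir_eqI:
  assumes "(u, x) \<in> R" "dd x v < dd u v" "dd u v \<le> r"
  shows "dir u v = x"
proof -
  have "u \<noteq> v" using assms by auto
  then show ?thesis
    using unique_nearer[OF dir(1)[of u v] assms(1), of v] dir(2)[of u v] assms by auto
qed

text \<open>As \<open>unique_nearer\<close> also covers neighbours at equal distance, every step
  other than the one along \<open>dir\<close> leads away from \<open>v\<close>.\<close>

lemma dd_away:
  assumes "(u, x) \<in> R" "dd u v \<le> r" "u = v \<or> x \<noteq> dir u v"
  shows "dd x v = Suc (dd u v)"
proof (rule ccontr)
  assume "dd x v \<noteq> Suc (dd u v)"
  then have le: "dd x v \<le> dd u v" using dd_edge_le(1)[OF assms(1), of v] by linarith
  have ne: "u \<noteq> v" using le R_neq[OF assms(1)] by auto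
  have "x = dir u v"
    using unique_nearer[OF assms(1) dir(1)[OF ne assms(2)] assms(2) le] dir(2)[OF ne assms(2)] by auto
  then show False using assms(3) ne by simp
qed

text \<open>As in a tree, geodesics that leave \<open>x\<close> in different directions join to a
  geodesic. The induction advances \<open>x\<close> along the second one; the first then arrives
  from the vertex just left, so the directions still differ.\<close>

lemma dd_concat:
  assumes "dd u x + dd x c \<le> r" "x \<noteq> c" "x = u \<or> dir x u \<noteq> dir x c"
  shows "dd u c = dd u x + dd x c \<and> dir c u = dir c x"
  using assms
proof (induction "dd x c" arbitrary: x u)
  case 0
  then show ?case by simp
next
  case (Suc m)
  define x1 where "x1 = dir x c"
  have xr: "dd x c \<le> r" "dd x u \<le> r" using Suc.prems(1) by (auto simp: dd_sym[of x u])
  have x1: "(x, x1) \<in> R" "dd x1 c = m"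
    using dir[OF Suc.prems(2) xr(1)] Suc.hyps(2) by (auto simp: x1_def)
  have d1: "dd x1 u = Suc (dd x u)" using x1 xr Suc.prems(3) by (intro dd_away) (auto simp: x1_def)
  have d1': "dd x1 u \<le> r" using d1 Suc.prems(1) Suc.hyps(2) dd_sym[of x u] by linarith
  have dx1: "dir x1 u = x" using d1 d1' R_sym[OF x1(1)] by (intro dir_eqI) auto
  have dx1': "dir x1 x = x"
    using dd_edge[OF R_sym[OF x1(1)]] Suc.prems(1) Suc.hyps(2) R_sym[OF x1(1)] by (intro dir_eqI) auto
  show ?case
  proof (cases "m = 0")
    case True
    then have "x1 = c" using x1 by auto
    then show ?thesis using d1 dx1 dx1' Suc.hyps(2) True dd_sym[of u] by auto
  next
    case False
    then have ne: "x1 \<noteq> c" using x1(2) by auto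
    have "dd x1 c \<le> r" using x1 Suc by simp
    then have "dir x1 c \<noteq> x" using dir(2)[OF ne] x1(2) Suc.hyps(2) by auto
    have 1: "dd u c = dd u x1 + dd x1 c \<and> dir c u = dir c x1"
      using Suc.prems(1) Suc.hyps(2) x1(2) d1 dx1 \<open>dir x1 c \<noteq> x\<close> ne dd_sym[of u]
      by (intro Suc.hyps(1)) auto
    \<comment> \<open>The induction hypothesis with start \<open>x\<close> instead of
      \<open>u\<close> identifies \<open>dir c x\<close> with \<open>dir c x1\<close>.\<close>
    have 2: "dd x c = dd x x1 + dd x1 c \<and> dir c x = dir c x1"
      using Suc.prems(1) Suc.hyps(2) x1(2) dx1' \<open>dir x1 c \<noteq> x\<close> ne dd_edge[OF x1(1)]
      by (intro Suc.hyps(1)) auto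
    show ?thesis using 1 2 d1 x1(2) Suc.hyps(2) dd_sym[of u] by simp
  qed
qed

end

text \<open>List \<open>Q\<close> sorted by \<open>f\<close> and rotate the list by half its length.
  Equal values form a contiguous block of at most half the length, so every element leaves its
  block.\<close>

lemma ex_class_changing_perm:
  fixes f :: "nat \<Rightarrow> nat"
  assumes fin: "finite Q" and small: "\<And>z. 2 * card {x \<in> Q. f x = z} \<le> card Q"
  shows "\<exists>\<pi>. bij_betw \<pi> Q Q \<and> (\<forall>x\<in>Q. f (\<pi> x) \<noteq> f x)"
proof -
  define xs where "xs = sort_key f (sorted_list_of_set Q)"
  define m where "m = card Q"
  have xs: "set xs = Q" "distinct xs" "length xs = m" "sorted (map f xs)"
    using fin by (auto simp: xs_def m_def)
  have nth_bij: "bij_betw (nth xs) {..<m} Q"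
    using bij_betw_nth[OF xs(2)] xs(1,3) by blast
  have no_long_block: "2 * (j - i + 1) \<le> m" if ij: "i \<le> j" "j < m" "f (xs ! i) = f (xs ! j)" for i j
  proof -
    have "nth xs ` {i..j} \<subseteq> {x \<in> Q. f x = f (xs ! i)}"
    proof
      fix x assume "x \<in> nth xs ` {i..j}"
      then obtain p where p: "i \<le> p" "p \<le> j" "x = xs ! p" by auto
      have "f (xs ! i) \<le> f (xs ! p)" "f (xs ! p) \<le> f (xs ! j)"
        using sorted_nth_mono[OF xs(4), of i p] sorted_nth_mono[OF xs(4), of p j] p ij xs(3) by auto
      then show "x \<in> {x \<in> Q. f x = f (xs ! i)}" using p ij xs by auto
    qed
    then have "card (nth xs ` {i..j}) \<le> card {x \<in> Q. f x = f (xs ! i)}"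
      using fin by (intro card_mono) auto
    moreover have "card (nth xs ` {i..j}) = j - i + 1"
    proof -
      have "inj_on (nth xs) {i..j}"
        using bij_betw_imp_inj_on[OF nth_bij] by (rule inj_on_subset) (use ij in auto)
      then show ?thesis using ij by (simp add: card_image)
    qed
    ultimately show ?thesis using small[of "f (xs ! i)"] m_def by simp
  qed
  define h where "h = m div 2"
  define rot where "rot i = (i + h) mod m" for i
  have "inj_on rot {..<m}"
  proof (rule inj_onI)
    fix i j assume "i \<in> {..<m}" "j \<in> {..<m}" "rot i = rot j"
    then show "i = j" unfolding rot_def h_def
      by (auto simp: mod_if split: if_splits)
  qed
  moreover have "rot ` {..<m} \<subseteq> {..<m}" by (auto simp: rot_def)
  ultimately have rot_bij: "bij_betw rot {..<m} {..<m}"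
    by (simp add: bij_betw_def endo_inj_surj)
  have rot_diff: "f (xs ! rot i) \<noteq> f (xs ! i)" if i: "i < m" for i
  proof
    assume eq: "f (xs ! rot i) = f (xs ! i)"
    show False
    proof (cases "i + h < m")
      case True
      then have "rot i = i + h" by (simp add: rot_def)
      then show False using no_long_block[of i "i + h"] True eq by (simp add: h_def)
    next
      case False
      then have "rot i = i + h - m" using i by (simp add: rot_def h_def mod_if)
      then show False using no_long_block[of "i + h - m" i] False i eq by (simp add: h_def) linarith
    qed
  qed
  define \<pi> where "\<pi> = nth xs \<circ> rot \<circ> the_inv_into {..<m} (nth xs)"
  have "bij_betw \<pi> Q Q" unfolding \<pi>_def
    using bij_betw_trans[OF bij_betw_trans[OF bij_betw_the_inv_into[OF nth_bij] rot_bij] nth_bij]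
    by (simp add: comp_assoc)
  moreover have "f (\<pi> x) \<noteq> f x" if "x \<in> Q" for x
  proof -
    obtain i where i: "i < m" "x = xs ! i" using xs \<open>x \<in> Q\<close> by (metis in_set_conv_nth)
    then have "the_inv_into {..<m} (nth xs) x = i"
      using bij_betw_imp_inj_on[OF nth_bij] by (simp add: the_inv_into_f_f)
    then show ?thesis using rot_diff i by (simp add: \<pi>_def)
  qed
  ultimately show ?thesis by blast
qed

section \<open>Centroids, growth of spheres and nets\<close>

context high_girth_graph
begin

text \<open>The centroid minimises the sum of distances to \<open>Q\<close>. A step into branch
  \<open>z\<close> gains one for each point of that branch and loses at most one for every other
  point, so no branch holds more than half of \<open>Q\<close>. The clause for singletons serves
  \<open>ex_centroid_perm\<close>.\<close>

lemma ex_centroid: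
  assumes Q: "Q \<subseteq> {0..<n}" "Q \<noteq> {}" and D: "\<And>x y. x \<in> Q \<Longrightarrow> y \<in> Q \<Longrightarrow> dd x y \<le> D" "2 * D \<le> r"
  shows "\<exists>c. (\<forall>x\<in>Q. dd x c \<le> 2 * D) \<and> (\<forall>z. 2 * card {x \<in> Q. x \<noteq> c \<and> dir c x = z} \<le> card Q) \<and>
    (card Q = 1 \<longrightarrow> c \<in> Q)"
proof -
  have fin: "finite Q" using Q finite_subset by blast
  define f where "f c = (\<Sum>q\<in>Q. dd c q)" for c
  define c where "c = (ARG_MIN f c. c \<in> {0..<n})"
  obtain q0 where q0: "q0 \<in> Q" using Q by blast
  have "is_arg_min f (\<lambda>c. c \<in> {0..<n}) c"
    unfolding c_def by (rule is_arg_min_arg_min_nat[where x = q0]) (use q0 Q in auto)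
  then have c: "c < n" and min: "\<And>z. z < n \<Longrightarrow> f c \<le> f z"
    by (auto simp: is_arg_min_linorder)
  \<comment> \<open>If all of \<open>Q\<close> were farther than \<open>D\<close> from
    \<open>c\<close>, then \<open>q0\<close> would have a smaller sum.\<close>
  have "\<exists>q\<in>Q. dd c q \<le> D"
  proof (rule ccontr)
    assume "\<not> ?thesis"
    then have "(\<Sum>q\<in>Q. D) < f c"
      unfolding f_def using fin Q by (intro sum_strict_mono) auto
    moreover have "f q0 \<le> (\<Sum>q\<in>Q. D)" unfolding f_def using D q0 by (intro sum_mono) auto
    moreover have "f c \<le> f q0" using min q0 Q by auto
    ultimately show False by simp
  qed
  then obtain q where q: "q \<in> Q" "dd c q \<le> D" by blast
  have near: "dd c x \<le> 2 * D" if "x \<in> Q" for x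
    using dd_triangle[of c x q] q D(1)[OF q(1) that] by linarith
  have "2 * card {x \<in> Q. x \<noteq> c \<and> dir c x = z} \<le> card Q" for z
  proof (cases "{x \<in> Q. x \<noteq> c \<and> dir c x = z} = {}")
    case True
    then show ?thesis by (simp only: card.empty)
  next
    case False
    let ?Z = "{x \<in> Q. x \<noteq> c \<and> dir c x = z}"
    obtain x where x: "x \<in> ?Z" using False by blast
    have edge: "(c, z) \<in> R" using x dir(1)[of c x] near[of x] D(2) by auto
    have "f z + card ?Z \<le> f c + card (Q - ?Z)"
    proof -
      have 1: "(\<Sum>q\<in>?Z. dd z q + 1) = (\<Sum>q\<in>?Z. dd c q)"
      proof (rule sum.cong[OF refl])
        fix q assume "q \<in> ?Z"
        then show "dd z q + 1 = dd c q" using dir(2)[of c q] near[of q] D(2) by simp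
      qed
      have 2: "(\<Sum>q\<in>Q - ?Z. dd z q) \<le> (\<Sum>q\<in>Q - ?Z. dd c q + 1)"
        using dd_edge_le(1)[OF edge] by (intro sum_mono) auto
      have 3: "f v = (\<Sum>q\<in>?Z. dd v q) + (\<Sum>q\<in>Q - ?Z. dd v q)" for v
        unfolding f_def using fin sum.subset_diff[of ?Z Q "dd v"] by simp
      have 4: "(\<Sum>q\<in>?Z. dd z q + 1) = (\<Sum>q\<in>?Z. dd z q) + card ?Z"
        "(\<Sum>q\<in>Q - ?Z. dd c q + 1) = (\<Sum>q\<in>Q - ?Z. dd c q) + card (Q - ?Z)"
        by (simp_all only: sum.distrib card_eq_sum)
      show ?thesis using 1 2 3[of z] 3[of c] 4 by linarith
    qed
    moreover have "f c \<le> f z" using min R_less[OF edge] by blast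
    moreover have "card (Q - ?Z) = card Q - card ?Z" "card ?Z \<le> card Q"
      using fin by (auto intro: card_Diff_subset card_mono)
    ultimately show ?thesis by linarith
  qed
  moreover have "c \<in> Q" if Q1: "card Q = 1"
  proof -
    obtain x where "Q = {x}" using Q1 by (auto simp: card_Suc_eq numeral_eq_Suc)
    then have "f c \<le> 0" using min[of x] Q by (simp add: f_def)
    then show ?thesis using \<open>Q = {x}\<close> by (simp add: f_def)
  qed
  moreover have "\<forall>x\<in>Q. dd x c \<le> 2 * D" using near by (simp add: dd_sym)
  ultimately show ?thesis by blast
qed

lemma ex_centroid_perm:
  assumes Q: "Q \<subseteq> {0..<n}" and D: "\<And>x y. x \<in> Q \<Longrightarrow> y \<in> Q \<Longrightarrow> dd x y \<le> D" "2 * D \<le> r"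
  shows "\<exists>c \<pi>. bij_betw \<pi> Q Q \<and> (\<forall>x\<in>Q. dd x c \<le> 2 * D) \<and>
    (\<forall>x\<in>Q. x \<noteq> c \<longrightarrow> \<pi> x \<noteq> c \<longrightarrow> dir c x \<noteq> dir c (\<pi> x))"
proof (cases "Q = {}")
  case True
  then show ?thesis by auto
next
  case False
  have fin: "finite Q" using Q finite_subset by blast
  obtain c where c: "\<forall>x\<in>Q. dd x c \<le> 2 * D" "card Q = 1 \<longrightarrow> c \<in> Q"
    "\<And>z. 2 * card {x \<in> Q. x \<noteq> c \<and> dir c x = z} \<le> card Q"
    using ex_centroid[OF Q False D] by blast
  show ?thesis
  \<comment> \<open>A singleton has only the identity as a permutation, which is admissible because
    its centroid is the point itself.\<close>
  proof (cases "card Q = 1")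
    case True
    then obtain x where "Q = {x}" by (auto simp: card_Suc_eq numeral_eq_Suc)
    then show ?thesis using c True by (intro exI[of _ c] exI[of _ id]) auto
  next
    case False
    then have two: "2 \<le> card Q" using \<open>Q \<noteq> {}\<close> fin
      by (metis One_nat_def Suc_1 Suc_leI card_gt_0_iff le_neq_implies_less)
    \<comment> \<open>The centre forms a class of its own, with value \<open>0\<close>. It has at
      most one element, which is at most half of \<open>Q\<close> since
      \<open>2 \<le> card Q\<close>.\<close>
    define f where "f x = (if x = c then 0 else Suc (dir c x))" for x
    have "2 * card {x \<in> Q. f x = z} \<le> card Q" for z
    proof (cases z)
      case 0
      then have "{x \<in> Q. f x = z} \<subseteq> {c}" by (auto simp: f_def split: if_splits)
      then have "card {x \<in> Q. f x = z} \<le> 1" using card_mono[of "{c}"] by simp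
      then show ?thesis using two by linarith
    next
      case (Suc y)
      then have "{x \<in> Q. f x = z} = {x \<in> Q. x \<noteq> c \<and> dir c x = y}" by (auto simp: f_def)
      then show ?thesis using c(3) by simp
    qed
    from ex_class_changing_perm[OF fin this] obtain \<pi>
      where "bij_betw \<pi> Q Q" "\<forall>x\<in>Q. f (\<pi> x) \<noteq> f x" by blast
    then show ?thesis using c(1) unfolding f_def by (intro exI[of _ c] exI[of _ \<pi>]) auto
  qed
qed

text \<open>A vertex on the sphere of radius \<open>m\<close> has at most one neighbour that is not
  on the next sphere, and a vertex \<open>x\<close> on the next sphere comes only from
  \<open>dir x v\<close>. So each sphere is at least \<open>d - 1\<close> times as large as the one
  before.\<close>

lemma sphere_growth:
  assumes full: "\<And>w. dd w v < m \<Longrightarrow> card (R `` {w}) = d" and m: "m \<le> r"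
  shows "finite {w. dd w v = m} \<and> (d - 1) ^ m \<le> card {w. dd w v = m}"
  using assms
proof (induction m)
  case 0
  then show ?case by simp
next
  case (Suc m)
  let ?S = "\<lambda>m. {w. dd w v = m}"
  have IH: "finite (?S m)" "(d - 1) ^ m \<le> card (?S m)" using Suc by auto
  define P where "P = (SIGMA y:?S m. {x. (y, x) \<in> R \<and> dd x v = Suc m})"
  have fS: "finite (?S (Suc m))"
    by (rule finite_subset[OF _ conjunct1[OF card_ball[OF Suc.prems(2), of v]]])
      (auto simp: dd_sym)
  have "(d - 1) ^ Suc m \<le> (\<Sum>y\<in>?S m. d - 1)" using IH by (simp add: mult.commute)
  also have "\<dots> \<le> (\<Sum>y\<in>?S m. card {x. (y, x) \<in> R \<and> dd x v = Suc m})"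
  proof (rule sum_mono)
    fix y assume y: "y \<in> ?S m"
    have "R `` {y} - {dir y v} \<subseteq> {x. (y, x) \<in> R \<and> dd x v = Suc m}"
      using dd_away[of y _ v] y Suc.prems(2) by auto
    moreover have "finite {x. (y, x) \<in> R \<and> dd x v = Suc m}"
      by (rule finite_subset[OF _ fS]) auto
    ultimately have "card (R `` {y} - {dir y v}) \<le> card {x. (y, x) \<in> R \<and> dd x v = Suc m}"
      by (rule card_mono[rotated])
    moreover have "d - 1 \<le> card (R `` {y} - {dir y v})"
      using Suc.prems(1)[of y] y diff_card_le_card_Diff[of "{dir y v}" "R `` {y}"] by simp
    ultimately show "d - 1 \<le> card {x. (y, x) \<in> R \<and> dd x v = Suc m}" by linarith
  qed
  also have "\<dots> = card P"
    unfolding P_def using IH(1)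
    by (subst card_SigmaI) (auto intro: finite_subset[OF _ fS])
  also have "\<dots> \<le> card (?S (Suc m))"
  proof (rule card_inj_on_le[where f = snd])
    show "inj_on snd P"
    proof (rule inj_onI)
      fix a b assume ab: "a \<in> P" "b \<in> P" "snd a = snd b"
      have "fst p = dir (snd p) v" if "p \<in> P" for p
        using that Suc.prems(2) unfolding P_def
        by (intro dir_eqI[symmetric]) (auto intro: R_sym)
      then show "a = b" using ab by (metis prod.collapse)
    qed
  qed (auto simp: P_def fS)
  finally show ?case using fS by simp
qed

definition deficient :: "nat set" where
  "deficient = {w. w < n \<and> card (R `` {w}) < d}"

text \<open>Among the vertices farther than \<open>m\<close> from all deficient ones, take a maximal
  set with pairwise distances above \<open>2 * m\<close>. Its balls of radius \<open>m\<close> are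
  disjoint and have at least \<open>(d - 1) ^ m\<close> elements; \<open>k\<close> is its size. All
  vertices near deficient ones are added to the net.\<close>

lemma ex_dominating_set:
  assumes m: "2 * m \<le> r"
  shows "\<exists>S. S \<subseteq> {0..<n} \<and> (\<forall>v<n. \<exists>s\<in>S. dd v s \<le> 2 * m) \<and>
    (\<exists>k. k * (d - 1) ^ m \<le> n \<and> card S \<le> k + card deficient * (d + 1) ^ m)"
proof -
  define Exc where "Exc = {v. v < n \<and> (\<exists>w\<in>deficient. dd w v \<le> m)}"
  have fdef: "finite deficient" by (simp add: deficient_def)
  have cExc: "card Exc \<le> card deficient * (d + 1) ^ m"
  proof -
    have "card Exc \<le> card (\<Union>w\<in>deficient. {v. dd w v \<le> m})"
      using card_ball m fdef by (intro card_mono) (auto simp: Exc_def)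
    also have "\<dots> \<le> (\<Sum>w\<in>deficient. card {v. dd w v \<le> m})" by (rule card_UN_le[OF fdef])
    also have "\<dots> \<le> (\<Sum>w\<in>deficient. (d + 1) ^ m)" using card_ball m by (intro sum_mono) auto
    finally show ?thesis by simp
  qed
  define good where "good S \<longleftrightarrow> S \<subseteq> {0..<n} - Exc \<and> (\<forall>s\<in>S. \<forall>t\<in>S. s \<noteq> t \<longrightarrow> 2 * m < dd s t)" for S
  have "finite {S. good S}" by (rule finite_subset[of _ "Pow {0..<n}"]) (auto simp: good_def)
  moreover have "good {}" by (simp add: good_def)
  ultimately obtain S where S: "good S" and max: "\<And>S'. good S' \<Longrightarrow> S \<subseteq> S' \<Longrightarrow> S = S'"
    using finite_has_maximal[of "{S. good S}"] by blast
  have finS: "finite S" using S finite_subset by (auto simp: good_def)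
  have dom: "\<exists>s\<in>S \<union> Exc. dd v s \<le> 2 * m" if "v < n" for v
  proof (rule ccontr)
    assume no: "\<not> ?thesis"
    then have "v \<notin> S \<union> Exc" by force
    moreover have "good (insert v S)"
      using S no that \<open>v \<notin> S \<union> Exc\<close> by (auto simp: good_def dd_sym not_le)
    ultimately show False using max[of "insert v S"] by auto
  qed
  have ball: "(d - 1) ^ m \<le> card {w. dd w v \<le> m} \<and> finite {w. dd w v \<le> m} \<and> {w. dd w v \<le> m} \<subseteq> {0..<n}"
    if v: "v \<in> S" for v
  proof -
    have vn: "v < n" "v \<notin> Exc" using v S by (auto simp: good_def)
    have sub: "{w. dd w v \<le> m} \<subseteq> {0..<n}"
      using dd_less_n[of v] vn m dd_sym by (auto intro: order_trans)
    have "card (R `` {w}) = d" if "dd w v < m" for w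
    proof -
      have "w < n" using subsetD[OF sub, of w] that by simp
      then have "w \<notin> deficient" using vn that by (auto simp: Exc_def)
      then show ?thesis using deg[of w] \<open>w < n\<close> by (auto simp: deficient_def)
    qed
    then have "(d - 1) ^ m \<le> card {w. dd w v = m}" using sphere_growth[of v m] m by auto
    also have "\<dots> \<le> card {w. dd w v \<le> m}"
      using finite_subset[OF sub] by (intro card_mono) auto
    finally show ?thesis using sub finite_subset[OF sub] by auto
  qed
  have "card S * (d - 1) ^ m \<le> (\<Sum>v\<in>S. card {w. dd w v \<le> m})"
    using sum_mono[of S "\<lambda>_. (d - 1) ^ m"] ball by simp
  also have "\<dots> = card (\<Union>v\<in>S. {w. dd w v \<le> m})"
  proof (rule card_UN_disjoint[symmetric, OF finS])
    show "\<forall>i\<in>S. finite {w. dd w i \<le> m}" using ball by blast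
    show "\<forall>i\<in>S. \<forall>j\<in>S. i \<noteq> j \<longrightarrow> {w. dd w i \<le> m} \<inter> {w. dd w j \<le> m} = {}"
    proof (intro ballI impI, rule ccontr)
      fix i j assume ij: "i \<in> S" "j \<in> S" "i \<noteq> j" "{w. dd w i \<le> m} \<inter> {w. dd w j \<le> m} \<noteq> {}"
      then obtain w where "dd w i \<le> m" "dd w j \<le> m" by blast
      then have "dd i j \<le> 2 * m" using dd_triangle[of i j w] dd_sym[of i w] by linarith
      moreover have "2 * m < dd i j" using S ij(1-3) unfolding good_def by blast
      ultimately show False by simp
    qed
  qed
  also have "\<dots> \<le> card {0..<n}" using ball by (intro card_mono) auto
  finally have cS: "card S * (d - 1) ^ m \<le> n" by simp
  have "card (S \<union> Exc) \<le> card S + card deficient * (d + 1) ^ m"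
    using card_Un_le[of S Exc] cExc by linarith
  moreover have "S \<union> Exc \<subseteq> {0..<n}" using S by (auto simp: good_def Exc_def)
  ultimately show ?thesis using dom cS by (intro exI[of _ "S \<union> Exc"]) auto
qed

text \<open>The hypothesis is the maximality of the graph: the ball around any one deficient vertex
  contains them all.\<close>

lemma card_deficient:
  assumes "\<And>u v. u < n \<Longrightarrow> v < n \<Longrightarrow> card (R `` {u}) < d \<Longrightarrow> card (R `` {v}) < d \<Longrightarrow>
    \<exists>k\<le>2 * r + 1. (u, v) \<in> R ^^ k"
  shows "card deficient \<le> (d + 1) ^ (2 * r + 1)"
proof (cases "deficient = {}")
  case False
  then obtain u where u: "u \<in> deficient" by blast
  have ball: "finite {v. \<exists>k\<le>2 * r + 1. (u, v) \<in> R ^^ k}"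
    "card {v. \<exists>k\<le>2 * r + 1. (u, v) \<in> R ^^ k} \<le> (d + 1) ^ (2 * r + 1)"
    using card_relpow_ball[OF finR deg] by blast+
  have "card deficient \<le> card {v. \<exists>k\<le>2 * r + 1. (u, v) \<in> R ^^ k}"
    using u assms by (intro card_mono[OF ball(1)]) (auto simp: deficient_def)
  then show ?thesis using ball(2) by linarith
qed simp

end

section \<open>Trajectories without backtracking\<close>

lemma sum_orbit:
  fixes f :: "'a \<Rightarrow> real"
  assumes "bij_betw \<Psi> \<Omega> \<Omega>"
  shows "(\<Sum>\<omega>\<in>\<Omega>. \<Sum>i<j. f ((\<Psi> ^^ i) \<omega>)) = j * sum f \<Omega>"
proof -
  have "(\<Sum>\<omega>\<in>\<Omega>. f ((\<Psi> ^^ i) \<omega>)) = sum f \<Omega>" for i :: nat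
    by (rule sum.reindex_bij_betw) (rule bij_betw_funpow[OF assms])
  then show ?thesis by (subst sum.swap) simp
qed

text \<open>Four penalties are averaged over all starting points: the visits to \<open>Bad\<close>,
  \<open>2 / j\<close> times the visits to \<open>Slow\<close>, a start in \<open>Slow\<close>, and
  the total of \<open>f\<close> divided by \<open>K\<close>. By \<open>sum_orbit\<close> the average
  is below 1, so at some point each penalty is below 1. The factor 3 is 2 for the visits and 1 for
  the start.\<close>

lemma ex_good_orbit:
  fixes f :: "'a \<Rightarrow> real"
  assumes \<Omega>: "finite \<Omega>" "bij_betw \<Psi> \<Omega> \<Omega>" "Bad \<subseteq> \<Omega>" "Slow \<subseteq> \<Omega>"
    and f: "\<And>\<omega>. 0 \<le> f \<omega>" and pos: "0 < j" "0 < K"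
    and avg: "j * card Bad + 3 * card Slow + j * sum f \<Omega> / K < card \<Omega>"
  shows "\<exists>\<omega>\<in>\<Omega>. \<omega> \<notin> Slow \<and> (\<forall>i<j. (\<Psi> ^^ i) \<omega> \<notin> Bad) \<and>
    2 * card {i. i < j \<and> (\<Psi> ^^ i) \<omega> \<in> Slow} \<le> j \<and> (\<Sum>i<j. f ((\<Psi> ^^ i) \<omega>)) \<le> K"
proof -
  define ind :: "'a set \<Rightarrow> 'a \<Rightarrow> real" where "ind A \<omega> = of_bool (\<omega> \<in> A)" for A \<omega>
  define b where "b \<omega> = (\<Sum>i<j. ind Bad ((\<Psi> ^^ i) \<omega>))" for \<omega>
  define s where "s \<omega> = (\<Sum>i<j. ind Slow ((\<Psi> ^^ i) \<omega>))" for \<omega>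
  define l where "l \<omega> = (\<Sum>i<j. f ((\<Psi> ^^ i) \<omega>))" for \<omega>
  have ind: "sum (ind A) \<Omega> = real (card A)" if "A \<subseteq> \<Omega>" for A
    using that \<Omega>(1) by (simp add: ind_def Int_absorb1)
  have "(\<Sum>\<omega>\<in>\<Omega>. b \<omega> + 2 / j * s \<omega> + ind Slow \<omega> + l \<omega> / K) =
      sum b \<Omega> + 2 / j * sum s \<Omega> + card Slow + sum l \<Omega> / K"
    using ind[OF \<Omega>(4)] by (simp add: sum.distrib sum_distrib_left sum_divide_distrib)
  also have "\<dots> = j * card Bad + 2 / j * (j * card Slow) + card Slow + j * sum f \<Omega> / K"
    unfolding b_def s_def l_def sum_orbit[OF \<Omega>(2)] ind[OF \<Omega>(3)] ind[OF \<Omega>(4)] by simp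
  also have "\<dots> < card \<Omega>" using avg pos by (simp add: field_simps)
  also have "\<dots> = (\<Sum>\<omega>\<in>\<Omega>. 1)" by simp
  finally obtain \<omega> where \<omega>: "\<omega> \<in> \<Omega>" "b \<omega> + 2 / j * s \<omega> + ind Slow \<omega> + l \<omega> / K < 1"
    using sum_mono[of \<Omega> "\<lambda>_. 1" "\<lambda>\<omega>. b \<omega> + 2 / j * s \<omega> + ind Slow \<omega> + l \<omega> / K"]
    by (meson linorder_not_less)
  have nn: "0 \<le> b \<omega>" "0 \<le> 2 / j * s \<omega>" "0 \<le> ind Slow \<omega>" "0 \<le> l \<omega> / K"
    using f pos by (auto simp: b_def s_def l_def ind_def intro!: sum_nonneg divide_nonneg_nonneg)
  have lt: "b \<omega> < 1" "2 / j * s \<omega> < 1" "ind Slow \<omega> < 1" "l \<omega> / K < 1"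
    using \<omega>(2) nn by linarith+
  have "\<omega> \<notin> Slow" using lt(3) by (auto simp: ind_def)
  moreover have "(\<Psi> ^^ i) \<omega> \<notin> Bad" if "i < j" for i
  proof
    assume "(\<Psi> ^^ i) \<omega> \<in> Bad"
    then have "1 \<le> b \<omega>"
      unfolding b_def using member_le_sum[of i "{..<j}" "\<lambda>i. ind Bad ((\<Psi> ^^ i) \<omega>)"] that
      by (simp add: ind_def)
    then show False using lt by simp
  qed
  moreover have "s \<omega> = card {i. i < j \<and> (\<Psi> ^^ i) \<omega> \<in> Slow}"
    by (simp add: s_def ind_def Int_def)
  then have "2 * card {i. i < j \<and> (\<Psi> ^^ i) \<omega> \<in> Slow} \<le> j"
    using lt(2) pos by (simp add: field_simps)
  moreover have "l \<omega> \<le> K" using lt(4) pos by (simp add: field_simps)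
  ultimately show ?thesis using \<omega>(1) unfolding l_def by blast
qed

section \<open>Darts and trajectories\<close>

context high_girth_graph
begin

text \<open>Each vertex has \<open>d\<close> slots. The neighbour in slot \<open>k\<close> of \<open>u\<close> is \<open>nbr u k\<close>, which is \<open>u\<close>
  itself if the slot is unused. A pair of a vertex and a slot is a dart, and \<open>rv\<close> reverses darts.\<close>

definition idx :: "nat \<Rightarrow> nat \<Rightarrow> nat" where
  "idx u w = card {z \<in> R `` {u}. z < w}"

definition nbr :: "nat \<Rightarrow> nat \<Rightarrow> nat" where
  "nbr u k = (if \<exists>w. (u, w) \<in> R \<and> idx u w = k then SOME w. (u, w) \<in> R \<and> idx u w = k else u)"

definition rv :: "nat \<times> nat \<Rightarrow> nat \<times> nat" where
  "rv = (\<lambda>(u, k). if nbr u k = u then (u, k) else (nbr u k, idx (nbr u k) u))"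

abbreviation darts :: "(nat \<times> nat) set" where
  "darts \<equiv> {0..<n} \<times> {0..<d}"

lemma idx_strict_mono: "(u, w) \<in> R \<Longrightarrow> w < w' \<Longrightarrow> idx u w < idx u w'"
  unfolding idx_def using finR by (intro psubset_card_mono) auto

lemma idx_inj: "(u, w) \<in> R \<Longrightarrow> (u, w') \<in> R \<Longrightarrow> idx u w = idx u w' \<Longrightarrow> w = w'"
  using idx_strict_mono[of u w w'] idx_strict_mono[of u w' w] by (metis less_irrefl linorder_neqE_nat)

lemma idx_less: "(u, w) \<in> R \<Longrightarrow> idx u w < card (R `` {u})"
  unfolding idx_def using finR by (intro psubset_card_mono) auto

lemma idx_less_d: "(u, w) \<in> R \<Longrightarrow> idx u w < d"
  using idx_less deg[of u] by (meson less_le_trans)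

lemma nbr: "nbr u k \<noteq> u \<Longrightarrow> (u, nbr u k) \<in> R \<and> idx u (nbr u k) = k"
  unfolding nbr_def using someI_ex[of "\<lambda>w. (u, w) \<in> R \<and> idx u w = k"] by (auto split: if_splits)

lemma nbr_idx: "(u, w) \<in> R \<Longrightarrow> nbr u (idx u w) = w"
  unfolding nbr_def using someI_ex[of "\<lambda>w'. (u, w') \<in> R \<and> idx u w' = idx u w"] idx_inj by auto

lemma nbr_less: "u < n \<Longrightarrow> nbr u k < n"
  using nbr[of u k] R_less by (cases "nbr u k = u") auto

lemma nbr_neq: "nbr u k \<noteq> u \<Longrightarrow> k \<noteq> k' \<Longrightarrow> nbr u k \<noteq> nbr u k'"
  using nbr[of u k] nbr[of u k'] by auto

text \<open>At a vertex of degree \<open>d\<close> the injective map \<open>idx u\<close> fills all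
  \<open>d\<close> slots.\<close>

lemma loop_deficient: "u < n \<Longrightarrow> k < d \<Longrightarrow> nbr u k = u \<Longrightarrow> u \<in> deficient"
proof (rule ccontr)
  assume u: "u < n" "k < d" "nbr u k = u" "u \<notin> deficient"
  then have "card (R `` {u}) = d" using deg[of u] by (auto simp: deficient_def)
  moreover have "inj_on (idx u) (R `` {u})" using idx_inj by (auto intro!: inj_onI)
  ultimately have "card (idx u ` (R `` {u})) = d" by (simp add: card_image)
  moreover have "idx u ` (R `` {u}) \<subseteq> {0..<d}" using idx_less_d by auto
  ultimately have "idx u ` (R `` {u}) = {0..<d}" by (simp add: card_subset_eq)
  then obtain w where "(u, w) \<in> R" "idx u w = k" using u(2) by (metis Image_singleton_iff atLeastLessThan_iff imageE le0)
  then show False using nbr_idx[of u w] R_neq[of u w] u(3) by simp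
qed

lemma rv_rv: "rv (rv a) = a"
proof (cases a)
  case (Pair u k)
  show ?thesis
  proof (cases "nbr u k = u")
    case False
    then have *: "(u, nbr u k) \<in> R" "idx u (nbr u k) = k" using nbr by auto
    then show ?thesis using nbr_idx[OF R_sym[OF *(1)]] False Pair by (simp add: rv_def)
  qed (simp add: Pair rv_def)
qed

lemma rv_darts: "a \<in> darts \<Longrightarrow> rv a \<in> darts"
  unfolding rv_def using nbr nbr_less idx_less_d R_sym by (auto split: prod.splits)

lemma bij_rv: "bij_betw rv darts darts"
proof (rule bij_betw_byWitness[where f' = rv])
  show "rv ` darts \<subseteq> darts" using rv_darts by blast
  show "rv ` darts \<subseteq> darts" by fact
qed (simp_all add: rv_rv)

lemma sum_darts_le:
  fixes f :: "nat \<times> nat \<Rightarrow> real"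
  assumes "\<And>a. 0 \<le> f a"
  shows "(\<Sum>(u, k)\<in>darts. if nbr u k = u then 0 else f (u, nbr u k)) \<le> sum f R"
proof -
  let ?D = "{(u, k) \<in> darts. nbr u k \<noteq> u}"
  have "(\<Sum>(u, k)\<in>darts. if nbr u k = u then 0 else f (u, nbr u k)) =
      (\<Sum>(u, k)\<in>?D. f (u, nbr u k))"
    by (rule sum.mono_neutral_cong_right) auto
  also have "\<dots> = sum f ((\<lambda>(u, k). (u, nbr u k)) ` ?D)"
  proof (subst sum.reindex)
    show "inj_on (\<lambda>(u, k). (u, nbr u k)) ?D" using nbr by (auto intro!: inj_onI) metis
  qed (auto simp: case_prod_unfold)
  also have "\<dots> \<le> sum f R" using finR assms nbr by (intro sum_mono2) auto
  finally show ?thesis .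
qed

text \<open>A vertex outside \<open>B\<close> is sent by \<open>\<pi>\<close> into another branch at its centre. A trajectory
  then moves along an edge. As long as this edge neither points back towards the centre nor
  arrives from the direction of the next centre, the concatenation of all these geodesics does not
  backtrack, so that the distance from the starting point grows with each step.\<close>

lemma trajectory:
  fixes x k :: "nat \<Rightarrow> nat"
  assumes step: "\<And>i. i < j \<Longrightarrow> (x (Suc i), k (Suc i)) = rv (\<pi> (x i), (k i + 1) mod d)"
    and slot: "\<And>i. i < j \<Longrightarrow> k i < d" and d2: "2 \<le> d"
    and noloop: "\<And>i. i < j \<Longrightarrow> nbr (\<pi> (x i)) ((k i + 1) mod d) \<noteq> \<pi> (x i)"
    and slow: "\<And>i. i < j \<Longrightarrow> x i \<in> B \<Longrightarrow> \<pi> (x i) = x i"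
    and fast: "\<And>i. i < j \<Longrightarrow> x i \<notin> B \<Longrightarrow> s \<le> dd (x i) (c i) \<and> dd (x i) (c i) \<le> M \<and>
      \<pi> (x i) \<noteq> c i \<and> dd (\<pi> (x i)) (c i) \<le> M \<and> dir (c i) (x i) \<noteq> dir (c i) (\<pi> (x i)) \<and>
      nbr (x i) (k i) \<noteq> dir (x i) (c i) \<and>
      nbr (\<pi> (x i)) ((k i + 1) mod d) \<noteq> dir (\<pi> (x i)) (c i)"
    and s: "0 < s" and range: "g + 2 * M + j \<le> r"
    and far: "r + 1 < s * card {i. i < j \<and> x i \<notin> B}"
  shows "\<exists>i<j. x i \<notin> B \<and> g \<le> dd (x 0) (x i)"
proof (rule ccontr)
  assume "\<not> ?thesis"
  then have close: "x i \<in> B \<or> dd (x 0) (x i) < g" if "i < j" for i using that by force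
  define u where "u = x 0"
  \<comment> \<open>Since \<open>rv\<close> stores the reversed dart, slot \<open>k i\<close> points
    back along the last edge; the invariant says that this is also the direction to the start. The
    last clause counts \<open>s\<close> for each jump and finally contradicts
    \<open>dd_le\<close>.\<close>
  have "i \<le> j \<Longrightarrow> dd u (x i) \<le> g + 2 * M + i \<and> (x i = u \<or> dir (x i) u = nbr (x i) (k i)) \<and>
    s * card {i'. i' < i \<and> x i' \<notin> B} \<le> dd u (x i)" for i
  proof (induction i)
    case 0
    then show ?case by (simp add: u_def)
  next
    case (Suc i)
    then have i: "i < j" and IH: "dd u (x i) \<le> g + 2 * M + i" "x i = u \<or> dir (x i) u = nbr (x i) (k i)"
      "s * card {i'. i' < i \<and> x i' \<notin> B} \<le> dd u (x i)" by auto
    define y where "y = \<pi> (x i)"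
    define x' where "x' = nbr y ((k i + 1) mod d)"
    have x': "x' \<noteq> y" using noloop[OF i] by (simp add: x'_def y_def)
    then have edge: "(y, x') \<in> R" unfolding x'_def using nbr by blast
    have next': "x (Suc i) = x'" "nbr x' (k (Suc i)) = y"
      using step[OF i, folded y_def] x' nbr_idx[OF R_sym[OF edge]]
      unfolding rv_def prod.case x'_def[symmetric] by auto
    have y: "dd u (x i) + (if x i \<in> B then 0 else s) \<le> dd u y \<and> dd u y \<le> g + 2 * M + i \<and>
      (y = u \<or> x' \<noteq> dir y u)"
    proof (cases "x i \<in> B")
      case True
      then have yx: "y = x i" using slow[OF i] y_def by simp
      \<comment> \<open>Without a jump, it is the shift of the slot that keeps the walk from
        returning along the edge by which it came.\<close>
      have "(k i + 1) mod d \<noteq> k i" using slot[OF i] d2 by (cases "k i + 1 = d") auto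
      then have "x' \<noteq> nbr (x i) (k i)" using nbr_neq[of y "(k i + 1) mod d" "k i"] x' yx
        by (simp add: x'_def)
      then show ?thesis using IH yx True by auto
    next
      case False
      note fast = fast[OF i False, folded y_def, folded x'_def]
      have S: "dd u (x i) < g" using close[OF i] False u_def by simp
      have "x i \<noteq> c i" using fast s by auto
      \<comment> \<open>Two concatenations: at \<open>x i\<close> the edge just used does not come
        from the centre, and at the centre the jump changes the branch.\<close>
      then have 1: "dd u (c i) = dd u (x i) + dd (x i) (c i)" "dir (c i) u = dir (c i) (x i)"
        using dd_concat[of u "x i" "c i"] S fast range IH(2) by auto
      have cy: "dd (c i) y \<le> M" using fast by (simp add: dd_sym[of "c i"])
      have 2: "dd u y = dd u (c i) + dd (c i) y" "dir y u = dir y (c i)"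
        using dd_concat[of u "c i" y] S fast range 1 cy by auto
      show ?thesis using 1 2 S fast cy False by auto
    qed
    have yr: "dd y u \<le> r" using y range i dd_sym[of y u] by linarith
    have d': "dd x' u = Suc (dd y u)" using dd_away[OF edge yr] y by blast
    have "dd x' u \<le> r" using d' y range i dd_sym[of y u] by linarith
    then have dir': "dir x' u = y" using dir_eqI[OF R_sym[OF edge], of u] d' by simp
    have "{i'. i' < Suc i \<and> x i' \<notin> B} = {i'. i' < i \<and> x i' \<notin> B} \<union> (if x i \<in> B then {} else {i})"
      by (auto simp: less_Suc_eq)
    then have "card {i'. i' < Suc i \<and> x i' \<notin> B} = card {i'. i' < i \<and> x i' \<notin> B} + (if x i \<in> B then 0 else 1)"
      by simp
    then have "s * card {i'. i' < Suc i \<and> x i' \<notin> B} \<le> dd u y"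
      using IH(3) y by (simp add: distrib_left split: if_splits)
    then show ?case using next' d' dir' y dd_sym[of u] by auto
  qed
  from this[of j] have "s * card {i. i < j \<and> x i \<notin> B} \<le> dd u (x j)" by simp
  then show False using dd_le[of u "x j"] far by simp
qed

end

section \<open>Short walks in the contracted graph\<close>

text \<open>An undirected edge as a number. \<open>prod_decode\<close> returns its ends in
  increasing order, as \<open>simple_cap_graph\<close> demands.\<close>

definition edge_code :: "nat \<Rightarrow> nat \<Rightarrow> nat" where
  "edge_code u v = prod_encode (min u v, max u v)"

lemma edge_code_commute: "edge_code u v = edge_code v u"
  by (simp add: edge_code_def min.commute max.commute)

lemma edge_code_eq: "edge_code u v = edge_code u' v' \<longleftrightarrow> u = u' \<and> v = v' \<or> u = v' \<and> v = u'"
  unfolding edge_code_def prod_encode_eq by (auto simp: min_def max_def split: if_splits)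

text \<open>Oriented edges that form a walk from node \<open>P\<close> to node \<open>Q\<close> after \<open>f\<close> has contracted the vertices
  to nodes. Edges inside a node are allowed, although they are absent from the contracted graph.\<close>

fun contr_walk :: "('v \<Rightarrow> 'w) \<Rightarrow> 'w \<Rightarrow> ('v \<times> 'v) list \<Rightarrow> 'w \<Rightarrow> bool" where
  "contr_walk f P [] Q \<longleftrightarrow> P = Q"
| "contr_walk f P ((a, b) # p) Q \<longleftrightarrow> f a = P \<and> contr_walk f (f b) p Q"

lemma contr_walk_append: "contr_walk f P p Q \<Longrightarrow> contr_walk f Q q S \<Longrightarrow> contr_walk f P (p @ q) S"
  by (induction f P p Q rule: contr_walk.induct) auto

definition walk_length :: "(nat \<Rightarrow> real) \<Rightarrow> (nat \<times> nat) list \<Rightarrow> real" where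
  "walk_length l p = (\<Sum>(a, b)\<leftarrow>p. l (edge_code a b))"

lemma walk_length_simps [simp]:
  "walk_length l [] = 0" "walk_length l ((a, b) # p) = l (edge_code a b) + walk_length l p"
  "walk_length l (p @ q) = walk_length l p + walk_length l q"
  by (simp_all add: walk_length_def)

section \<open>The graph with its vertices attached to terminals\<close>

locale attached_graph = high_girth_graph +
  fixes T :: "nat set" and t :: "nat \<Rightarrow> nat" and m :: nat
  assumes T: "T \<subseteq> {0..<n}" and t_T: "v < n \<Longrightarrow> t v \<in> T" and t_id: "v \<in> T \<Longrightarrow> t v = v"
    and t_near: "v < n \<Longrightarrow> dd v (t v) \<le> 2 * m" and m0: "0 < m" and d2: "2 \<le> d"
begin

definition XE :: "nat set" where "XE = (\<lambda>(u, v). edge_code u v) ` R"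

definition AE :: "nat set" where "AE = (\<lambda>v. edge_code v (t v)) ` {v. v < n \<and> t v \<noteq> v}"

text \<open>With these capacities the edges of the high-girth graph and the edges to the terminals have
  volume of the same order \<open>m n d\<close>.\<close>

definition cap :: "nat \<Rightarrow> real" where
  "cap e = (if e \<in> XE then 2 * real m else 0) + (if e \<in> AE then real d else 0)"

lemma finXE: "finite XE" unfolding XE_def using finR by simp

lemma finAE: "finite AE" unfolding AE_def by simp

text \<open>\<open>XE\<close> and \<open>AE\<close> may overlap; the sum still splits because an
  edge in both has both capacities added.\<close>

lemma sum_cap:
  fixes f :: "nat \<Rightarrow> real"
  shows "(\<Sum>e\<in>XE \<union> AE. cap e * f e) = 2 * real m * sum f XE + real d * sum f AE"
proof -
  have "(\<Sum>e\<in>XE \<union> AE. cap e * f e) =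
      (\<Sum>e\<in>XE \<union> AE. (if e \<in> XE then 2 * real m * f e else 0) + (if e \<in> AE then real d * f e else 0))"
    by (rule sum.cong) (auto simp: cap_def distrib_right)
  also have "\<dots> = (\<Sum>e\<in>XE. 2 * real m * f e) + (\<Sum>e\<in>AE. real d * f e)"
    using finXE finAE by (simp add: sum.distrib sum.If_cases Int_absorb1)
  finally show ?thesis by (simp add: sum_distrib_left)
qed

lemma sum_AE: "(\<Sum>v\<in>{v. v < n \<and> t v \<noteq> v}. f (edge_code v (t v))) = sum f AE"
  unfolding AE_def
proof (subst sum.reindex)
  \<comment> \<open>If the codes of \<open>v\<close> and \<open>v'\<close> agreed crosswise, then
    \<open>v = t v'\<close> would be a terminal, so that \<open>t v = v\<close>.\<close>
  show "inj_on (\<lambda>v. edge_code v (t v)) {v. v < n \<and> t v \<noteq> v}"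
    using t_T t_id by (auto intro!: inj_onI simp: edge_code_eq)
qed simp

lemma sum_R: "(\<Sum>(u, v)\<in>R. f (edge_code u v)) = (2::real) * sum f XE"
proof -
  let ?U = "{(u, v) \<in> R. u < v}" and ?D = "{(u, v) \<in> R. v < u}"
  have R: "R = ?U \<union> ?D" using R_neq by force
  have XU: "XE = (\<lambda>(u, v). edge_code u v) ` ?U"
  proof
    show "XE \<subseteq> (\<lambda>(u, v). edge_code u v) ` ?U"
    proof
      fix e assume "e \<in> XE"
      then obtain u v where uv: "(u, v) \<in> R" "e = edge_code u v" by (auto simp: XE_def)
      show "e \<in> (\<lambda>(u, v). edge_code u v) ` ?U"
      proof (cases "u < v")
        case False
        then have "(v, u) \<in> ?U" "e = edge_code v u"
          using uv R_neq[OF uv(1)] R_sym by (auto simp: edge_code_commute)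
        then show ?thesis by force
      qed (use uv in force)
    qed
  qed (auto simp: XE_def)
  have U: "(\<Sum>(u, v)\<in>?U. f (edge_code u v)) = sum f XE"
    unfolding XU
    by (subst sum.reindex) (auto intro!: inj_onI simp: edge_code_eq case_prod_unfold)
  have D: "(\<Sum>(u, v)\<in>?D. f (edge_code u v)) = (\<Sum>(u, v)\<in>?U. f (edge_code u v))"
    by (rule sum.reindex_bij_witness[where i = prod.swap and j = prod.swap])
      (auto simp: R_sym edge_code_commute)
  have "(\<Sum>(u, v)\<in>R. f (edge_code u v)) = (\<Sum>(u, v)\<in>?U. f (edge_code u v)) + (\<Sum>(u, v)\<in>?D. f (edge_code u v))"
    by (subst (1) R, rule sum.union_disjoint) (auto intro: finite_subset[OF _ finR])
  then show ?thesis using U D by simp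
qed

text \<open>This refutes a dual solution \<open>l\<close>. The 24 is three times 8: the attachment
  edge at either end and the trajectory between them each cost at most
  \<open>8 * Y / (n * d)\<close>.\<close>

lemma short_contr_walk:
  fixes pt :: "nat \<Rightarrow> 'w" and l :: "nat \<Rightarrow> real" and G j s :: nat
  defines "Y \<equiv> \<Sum>e\<in>XE \<union> AE. cap e * l e"
  assumes l: "\<And>e. 0 \<le> l e" and Y0: "0 < Y"
    and Gm: "4 * m \<le> G" and jm: "j \<le> m" and j0: "0 < j" and rG: "r = 12 * G" and s0: "0 < s" "s \<le> r"
    and sj: "2 * (r + 1) < s * j"
    and few: "2 * j * (card (pt ` {0..<n}) * ((d + 1) ^ s + 1) * d + 2 * n + card deficient * d) < n * d"
  shows "\<exists>u v p. u \<in> T \<and> v \<in> T \<and> G \<le> dd u v \<and> contr_walk pt (pt u) p (pt v) \<and> length p \<le> j + 2 \<and>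
    set p \<subseteq> {(a, b). a \<noteq> b \<and> edge_code a b \<in> XE \<union> AE} \<and> n * d * walk_length l p \<le> 24 * Y"
proof (rule ccontr)
  assume no: "\<not> ?thesis"
  have n0: "0 < n" using few by (cases n) auto
  have nd: "0 < real n * real d" using n0 d2 by simp
  define up where "up v = (if t v = v then [] else [(t v, v)])" for v
  define down where "down v = (if t v = v then [] else [(v, t v)])" for v
  define att where "att v = (if t v = v then 0 else l (edge_code v (t v)))" for v
  have up: "contr_walk pt (pt (t v)) (up v) (pt v)" "length (up v) \<le> 1" "walk_length l (up v) = att v"
    and down: "contr_walk pt (pt v) (down v) (pt (t v))" "length (down v) \<le> 1" "walk_length l (down v) = att v" for v
    by (auto simp: up_def down_def att_def edge_code_commute)
  have ends: "set (up v) \<subseteq> {(a, b). a \<noteq> b \<and> edge_code a b \<in> XE \<union> AE}"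
    "set (down v) \<subseteq> {(a, b). a \<noteq> b \<and> edge_code a b \<in> XE \<union> AE}" if "v < n" for v
    using that by (auto simp: up_def down_def AE_def edge_code_commute)
  \<comment> \<open>The vertices with a long attachment edge. By Markov's inequality they are at
    most an eighth of all vertices.\<close>
  define B where "B = {v. v < n \<and> 8 * Y < n * d * att v}"
  have lX: "0 \<le> sum l XE" "0 \<le> sum l AE" using l by (auto intro: sum_nonneg)
  have Y: "Y = 2 * real m * sum l XE + real d * sum l AE" unfolding Y_def by (rule sum_cap)
  have cB: "8 * card B \<le> n"
  proof -
    have "8 * Y * card B \<le> (\<Sum>v\<in>B. n * d * att v)"
      using sum_mono[of B "\<lambda>_. 8 * Y" "\<lambda>v. n * d * att v"] by (simp add: B_def mult.commute)
    also have "\<dots> \<le> (\<Sum>v\<in>{0..<n}. n * d * att v)"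
      using l by (intro sum_mono2) (auto simp: B_def att_def)
    also have "\<dots> = n * d * (\<Sum>v\<in>{v. v < n \<and> t v \<noteq> v}. l (edge_code v (t v)))"
      unfolding sum_distrib_left[symmetric]
      by (intro arg_cong[of _ _ "\<lambda>x. real (n * d) * x"] sum.mono_neutral_cong_right) (auto simp: att_def)
    also have "\<dots> = n * (d * sum l AE)" using sum_AE[of l] by simp
    also have "\<dots> \<le> n * Y" unfolding Y using lX by (intro mult_left_mono) auto
    finally have "Y * (8 * card B) \<le> Y * n" by (simp add: mult_ac)
    then show ?thesis using Y0 by simp
  qed
  have attB: "n * d * att v \<le> 8 * Y" if "v < n" "v \<notin> B" for v
    using that by (auto simp: B_def)
  \<comment> \<open>Going from \<open>t u\<close> up to \<open>u\<close>, freely to \<open>v\<close>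
    and down to \<open>t v\<close> is a short walk, so by assumption these terminals are closer than
    \<open>G\<close>. The two attachments add at most \<open>4 * m \<le> G\<close>.\<close>
  have diam: "dd u v \<le> 2 * G" if uv: "u < n" "v < n" "u \<notin> B" "v \<notin> B" "pt u = pt v" for u v
  proof -
    have "contr_walk pt (pt (t u)) (up u @ down v) (pt (t v))"
      using contr_walk_append[OF up(1)[of u]] down(1)[of v] uv(5) by simp
    moreover have "length (up u @ down v) \<le> j + 2" using up(2)[of u] down(2)[of v] by simp
    moreover have "set (up u @ down v) \<subseteq> {(a, b). a \<noteq> b \<and> edge_code a b \<in> XE \<union> AE}"
      using ends[OF uv(1)] ends[OF uv(2)] by simp
    moreover have "n * d * walk_length l (up u @ down v) \<le> 24 * Y"
      using attB[OF uv(1,3)] attB[OF uv(2,4)] Y0 up(3) down(3) by (simp add: distrib_left)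
    ultimately have "\<not> G \<le> dd (t u) (t v)" using no t_T uv(1,2) by blast
    then show ?thesis
      using dd_triangle[of u v "t u"] dd_triangle[of "t u" v "t v"] dd_sym[of "t v" v] t_near[OF uv(1)] t_near[OF uv(2)] Gm
      by linarith
  qed
  define Q where "Q P = {v. v < n \<and> v \<notin> B \<and> pt v = P}" for P
  have "\<exists>c \<pi>. bij_betw \<pi> (Q P) (Q P) \<and> (\<forall>x\<in>Q P. dd x c \<le> 2 * (2 * G)) \<and>
      (\<forall>x\<in>Q P. x \<noteq> c \<longrightarrow> \<pi> x \<noteq> c \<longrightarrow> dir c x \<noteq> dir c (\<pi> x))" for P
    using diam rG by (intro ex_centroid_perm) (auto simp: Q_def)
  then obtain cen perm where cen: "\<And>P. bij_betw (perm P) (Q P) (Q P)"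
    "\<And>P x. x \<in> Q P \<Longrightarrow> dd x (cen P) \<le> 4 * G"
    "\<And>P x. x \<in> Q P \<Longrightarrow> x \<noteq> cen P \<Longrightarrow> perm P x \<noteq> cen P \<Longrightarrow> dir (cen P) x \<noteq> dir (cen P) (perm P x)"
    by (simp add: mult.assoc[symmetric]) metis
  define c where "c x = cen (pt x)" for x
  \<comment> \<open>Discarded vertices stay put, so that \<open>\<pi>\<close> permutes all vertices
    and respects the parts.\<close>
  define \<pi> where "\<pi> x = (if x \<in> B then x else perm (pt x) x)" for x
  have \<pi>_Q: "\<pi> x < n \<and> \<pi> x \<notin> B \<and> pt (\<pi> x) = pt x" if "x < n" "x \<notin> B" for x
  proof -
    have "x \<in> Q (pt x)" using that by (simp add: Q_def)
    then have "perm (pt x) x \<in> Q (pt x)" using cen(1) bij_betwE by blast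
    then show ?thesis using that by (simp add: \<pi>_def Q_def)
  qed
  have \<pi>_B: "x \<in> B \<Longrightarrow> \<pi> x = x" for x by (simp add: \<pi>_def)
  have \<pi>_pt: "pt (\<pi> x) = pt x \<and> \<pi> x < n" if "x < n" for x using \<pi>_Q \<pi>_B that by (cases "x \<in> B") auto
  have inj\<pi>: "inj_on \<pi> {0..<n}"
  proof (rule inj_onI)
    fix x y assume xy: "x \<in> {0..<n}" "y \<in> {0..<n}" "\<pi> x = \<pi> y"
    have "x \<in> B \<longleftrightarrow> \<pi> x \<in> B" "y \<in> B \<longleftrightarrow> \<pi> y \<in> B"
      using xy \<pi>_Q[of x] \<pi>_Q[of y] \<pi>_B[of x] \<pi>_B[of y] by (metis atLeastLessThan_iff)+
    then have "x \<in> B \<longleftrightarrow> y \<in> B" "pt x = pt y"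
      using xy \<pi>_pt[of x] \<pi>_pt[of y] by auto
    moreover have "x = y" if "x \<notin> B" "y \<notin> B"
      using bij_betw_imp_inj_on[OF cen(1)[of "pt x"]] xy that calculation
      by (auto simp: \<pi>_def Q_def inj_on_def)
    ultimately show "x = y" using xy \<pi>_B by auto
  qed
  \<comment> \<open>The slot is shifted so that a vertex fixed by \<open>\<pi>\<close> is not left
    by the edge through which it was entered.\<close>
  define turn where "turn = (\<lambda>(x, k). (\<pi> x, (k + 1) mod d))"
  have turn_darts: "turn a \<in> darts" if "a \<in> darts" for a
    using that \<pi>_pt d2 by (auto simp: turn_def)
  have inj_turn: "inj_on turn darts"
  proof (rule inj_onI)
    fix a a' assume a: "a \<in> darts" "a' \<in> darts" "turn a = turn a'"
    obtain x k x' k' where xk: "a = (x, k)" "a' = (x', k')" by fastforce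
    have "(k + 1) mod d = (if k + 1 = d then 0 else k + 1)" "(k' + 1) mod d = (if k' + 1 = d then 0 else k' + 1)"
      using a xk by auto
    moreover have "(k + 1) mod d = (k' + 1) mod d" using a(3) xk by (simp add: turn_def)
    ultimately have "k = k'" by (auto split: if_splits)
    moreover have "x = x'" using inj_onD[OF inj\<pi>, of x x'] a xk by (simp add: turn_def)
    ultimately show "a = a'" using xk by simp
  qed
  have bij_turn: "bij_betw turn darts darts"
    unfolding bij_betw_def using inj_turn turn_darts
    by (intro conjI endo_inj_surj image_subsetI) auto
  define \<Psi> where "\<Psi> = rv \<circ> turn"
  have bij\<Psi>: "bij_betw \<Psi> darts darts" unfolding \<Psi>_def by (rule bij_betw_trans[OF bij_turn bij_rv])
  \<comment> \<open>The vertices whose jump starts too close to the centre or ends at it. In each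
    part they lie in a ball of radius \<open>s\<close> or are the one preimage of the
    centre.\<close>
  define Near where "Near = {x. x < n \<and> x \<notin> B \<and> (dd x (c x) < s \<or> \<pi> x = c x)}"
  \<comment> \<open>At most one dart at each vertex points towards the centre. This costs only
    \<open>n\<close> of about \<open>n * d\<close> darts, which is why \<open>d\<close> must be
    large compared with \<open>j\<close>.\<close>
  define Tow where "Tow = {(y, k) \<in> darts. nbr y k \<noteq> y \<and> nbr y k = dir y (c y)}"
  define Loop where "Loop = {(y, k) \<in> darts. nbr y k = y}"
  \<comment> \<open>In turn: an unsuitable jump, a departure that uses an empty slot or heads for
    the centre, and an arrival from the direction of the centre, read off from the reversed
    dart.\<close>
  define Bad where "Bad = Near \<times> {0..<d} \<union> {a \<in> darts. turn a \<in> Tow \<union> Loop} \<union> Tow"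
  have cNear: "card Near \<le> card (pt ` {0..<n}) * ((d + 1) ^ s + 1)"
  proof -
    have "card Near \<le> card (\<Union>P\<in>pt ` {0..<n}. {x \<in> Near. pt x = P})"
      by (intro card_mono) (auto simp: Near_def)
    also have "\<dots> \<le> (\<Sum>P\<in>pt ` {0..<n}. card {x \<in> Near. pt x = P})" by (rule card_UN_le) simp
    also have "\<dots> \<le> (\<Sum>P\<in>pt ` {0..<n}. (d + 1) ^ s + 1)"
    proof (rule sum_mono)
      fix P
      have fin: "finite {x. x < n \<and> x \<notin> B \<and> pt x = P \<and> \<pi> x = cen P}" by simp
      have "card {x. x < n \<and> x \<notin> B \<and> pt x = P \<and> \<pi> x = cen P} \<le> card {cen P}"
      proof (rule card_inj_on_le[of \<pi>])
        show "inj_on \<pi> {x. x < n \<and> x \<notin> B \<and> pt x = P \<and> \<pi> x = cen P}"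
          using inj\<pi> by (rule inj_on_subset) auto
      qed auto
      moreover have ball: "finite {x. dd (cen P) x \<le> s}" "card {x. dd (cen P) x \<le> s} \<le> (d + 1) ^ s"
        using card_ball[OF s0(2)] by auto
      moreover have "card {x \<in> Near. pt x = P} \<le>
          card ({x. dd (cen P) x \<le> s} \<union> {x. x < n \<and> x \<notin> B \<and> pt x = P \<and> \<pi> x = cen P})"
        using ball fin by (intro card_mono) (auto simp: Near_def c_def dd_sym[of "cen P"])
      ultimately show "card {x \<in> Near. pt x = P} \<le> (d + 1) ^ s + 1"
        using card_Un_le[of "{x. dd (cen P) x \<le> s}" "{x. x < n \<and> x \<notin> B \<and> pt x = P \<and> \<pi> x = cen P}"]
        by simp
    qed
    finally show ?thesis by simp
  qed
  have cTow: "card Tow \<le> n"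
  proof -
    have "inj_on fst Tow" using nbr by (auto intro!: inj_onI simp: Tow_def) metis
    then have "card Tow \<le> card {0..<n}" by (rule card_inj_on_le) (auto simp: Tow_def)
    then show ?thesis by simp
  qed
  have cLoop: "card Loop \<le> card deficient * d"
  proof -
    have "Loop \<subseteq> deficient \<times> {0..<d}" using loop_deficient by (auto simp: Loop_def)
    then have "card Loop \<le> card (deficient \<times> {0..<d})"
      by (intro card_mono) (auto simp: deficient_def)
    then show ?thesis by (simp add: card_cartesian_product)
  qed
  have cBad: "card Bad \<le> card (pt ` {0..<n}) * ((d + 1) ^ s + 1) * d + 2 * n + card deficient * d"
  proof -
    have "card {a \<in> darts. turn a \<in> Tow \<union> Loop} \<le> card (Tow \<union> Loop)"
    proof (rule card_inj_on_le[of turn])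
      show "inj_on turn {a \<in> darts. turn a \<in> Tow \<union> Loop}" using inj_turn by (rule inj_on_subset) auto
      show "finite (Tow \<union> Loop)" by (rule finite_subset[of _ darts]) (auto simp: Tow_def Loop_def)
    qed auto
    moreover have "card (Near \<times> {0..<d}) \<le> card (pt ` {0..<n}) * ((d + 1) ^ s + 1) * d"
      using mult_le_mono1[OF cNear, of d] by (simp add: card_cartesian_product)
    moreover have "card Bad \<le> card (Near \<times> {0..<d}) + card {a \<in> darts. turn a \<in> Tow \<union> Loop} + card Tow"
      unfolding Bad_def
      using card_Un_le[of "Near \<times> {0..<d} \<union> {a \<in> darts. turn a \<in> Tow \<union> Loop}" Tow]
        card_Un_le[of "Near \<times> {0..<d}" "{a \<in> darts. turn a \<in> Tow \<union> Loop}"] by linarith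
    ultimately show ?thesis using card_Un_le[of Tow Loop] cTow cLoop by linarith
  qed
  define h where "h = (\<lambda>(y, k). if nbr y k = y then 0 else l (edge_code y (nbr y k)))"
  \<comment> \<open>The length of the edge traversed in the step that starts at \<open>a\<close>.
    Over all darts each edge is counted at most twice, and capacity \<open>2 * m\<close> pays for
    \<open>m\<close> such rounds.\<close>
  define f where "f a = h (turn a)" for a
  have h0: "0 \<le> h a" for a using l by (auto simp: h_def split: prod.splits)
  have sumf: "m * sum f darts \<le> Y"
  proof -
    have "sum f darts = sum h darts"
      unfolding f_def by (rule sum.reindex_bij_betw[OF bij_turn])
    also have "\<dots> \<le> (\<Sum>a\<in>R. case a of (u, v) \<Rightarrow> l (edge_code u v))"
      using sum_darts_le[of "\<lambda>a. l (edge_code (fst a) (snd a))"] l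
      by (simp add: h_def case_prod_unfold cong: if_cong)
    also have "\<dots> = 2 * sum l XE" by (rule sum_R)
    finally have "m * sum f darts \<le> m * (2 * sum l XE)" by (intro mult_left_mono) auto
    also have "\<dots> \<le> Y" unfolding Y using lX by simp
    finally show ?thesis .
  qed
  \<comment> \<open>The budget in \<open>ex_good_orbit\<close>: with this \<open>K\<close> the
    length accounts for at most 1/8 of the darts, \<open>Slow\<close> with its factor 3 for at most
    3/8, and \<open>Bad\<close> for less than 1/2.\<close>
  define K where "K = 8 * Y / (n * d)"
  define Slow where "Slow = B \<times> {0..<d}"
  have K0: "0 < K" using Y0 nd by (simp add: K_def)
  have avg: "j * card Bad + 3 * card Slow + j * sum f darts / K < card darts"
  proof -
    have "j * sum f darts \<le> m * sum f darts"
      using jm sum_nonneg[of darts f] h0 by (intro mult_right_mono) (simp_all add: f_def)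
    then have "j * sum f darts \<le> Y" using sumf by linarith
    then have "j * sum f darts / K \<le> Y / K" using K0 by (simp add: divide_right_mono)
    also have "Y / K = real n * real d / 8" using Y0 nd by (simp add: K_def)
    finally have 1: "j * sum f darts / K \<le> real n * real d / 8" .
    have "2 * j * card Bad < n * d" using le_less_trans[OF mult_le_mono2[OF cBad, of "2 * j"] few] .
    then have 2: "2 * (real j * real (card Bad)) < real n * real d"
      by (metis of_nat_less_iff of_nat_mult of_nat_numeral mult.assoc)
    have "8 * card Slow \<le> n * d"
      using mult_le_mono1[OF cB, of d] by (simp add: Slow_def card_cartesian_product)
    then have 3: "8 * real (card Slow) \<le> real n * real d"
      by (metis of_nat_le_iff of_nat_mult of_nat_numeral)
    have "card darts = n * d" by (simp add: card_cartesian_product)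
    then have 4: "real (card darts) = real n * real d" by simp
    show ?thesis unfolding 4 of_nat_add of_nat_mult of_nat_numeral using 1 2 3 nd by linarith
  qed
  have Bad_darts: "Bad \<subseteq> darts" by (auto simp: Bad_def Near_def Tow_def)
  have Slow_darts: "Slow \<subseteq> darts" by (auto simp: Slow_def B_def)
  obtain \<omega> where \<omega>: "\<omega> \<in> darts" "\<omega> \<notin> Slow" "\<And>i. i < j \<Longrightarrow> (\<Psi> ^^ i) \<omega> \<notin> Bad"
    "2 * card {i. i < j \<and> (\<Psi> ^^ i) \<omega> \<in> Slow} \<le> j" "(\<Sum>i<j. f ((\<Psi> ^^ i) \<omega>)) \<le> K"
    using ex_good_orbit[OF _ bij\<Psi> Bad_darts Slow_darts _ j0 K0 avg] h0 f_def by auto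
  define x where "x i = fst ((\<Psi> ^^ i) \<omega>)" for i
  define k where "k i = snd ((\<Psi> ^^ i) \<omega>)" for i
  have xk: "(\<Psi> ^^ i) \<omega> = (x i, k i)" for i by (simp add: x_def k_def)
  have xkd: "x i < n \<and> k i < d" for i
  proof -
    have "(\<Psi> ^^ i) \<omega> \<in> darts" using bij_betwE[OF bij_betw_funpow[OF bij\<Psi>, of i]] \<omega>(1) by blast
    then show ?thesis by (simp add: xk)
  qed
  have step: "(x (Suc i), k (Suc i)) = rv (\<pi> (x i), (k i + 1) mod d)" for i
  proof -
    have "(\<Psi> ^^ Suc i) \<omega> = rv (turn (x i, k i))" using xk[of i] by (simp add: \<Psi>_def)
    then show ?thesis using xk[of "Suc i"] by (simp del: funpow.simps add: turn_def)
  qed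
  have good: "x i \<notin> B \<Longrightarrow> s \<le> dd (x i) (c (x i)) \<and> \<pi> (x i) \<noteq> c (x i)" "(x i, k i) \<notin> Tow"
    "turn (x i, k i) \<notin> Tow" "turn (x i, k i) \<notin> Loop" if "i < j" for i
    using \<omega>(3)[OF that] xkd[of i] unfolding xk Bad_def by (auto simp: Near_def)
  have turn_xk: "turn (x i, k i) \<in> darts" for i using turn_darts xkd[of i] by auto
  have noloop: "nbr (\<pi> (x i)) ((k i + 1) mod d) \<noteq> \<pi> (x i)" if "i < j" for i
    using good(4)[OF that] turn_xk[of i] by (auto simp: Loop_def turn_def)
  \<comment> \<open>Parts have diameter at most \<open>2 * G\<close> after discarding, so centres
    are within \<open>4 * G\<close>. The range needed is \<open>2 * G + 8 * G + j\<close>, which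
    \<open>r = 12 * G\<close> allows.\<close>
  have "\<exists>i<j. x i \<notin> B \<and> 2 * G \<le> dd (x 0) (x i)"
  proof (rule trajectory[where \<pi> = \<pi> and k = k and c = "\<lambda>i. c (x i)" and M = "4 * G" and s = s])
    fix i assume i: "i < j"
    show "x i \<in> B \<Longrightarrow> \<pi> (x i) = x i" by (rule \<pi>_B)
    assume nB: "x i \<notin> B"
    have xn: "x i < n" using xkd by blast
    have xQ: "x i \<in> Q (pt (x i))" "\<pi> (x i) \<in> Q (pt (x i))"
      using xn nB \<pi>_Q[OF xn nB] by (auto simp: Q_def)
    have near: "s \<le> dd (x i) (c (x i))" "\<pi> (x i) \<noteq> c (x i)" using good(1)[OF i nB] by auto
    then have xc: "x i \<noteq> c (x i)" using s0 by auto
    have M: "dd (x i) (c (x i)) \<le> 4 * G" "dd (\<pi> (x i)) (c (x i)) \<le> 4 * G"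
      using cen(2) xQ by (auto simp: c_def)
    have "dir (c (x i)) (x i) \<noteq> dir (c (x i)) (\<pi> (x i))"
      using cen(3)[OF xQ(1)] xc near nB by (simp add: c_def \<pi>_def)
    moreover have "nbr (x i) (k i) \<noteq> dir (x i) (c (x i))"
    proof
      assume eq: "nbr (x i) (k i) = dir (x i) (c (x i))"
      then have "nbr (x i) (k i) \<noteq> x i" using dir(1)[OF xc] M rG R_neq by fastforce
      then show False using eq good(2)[OF i] xkd[of i] by (auto simp: Tow_def)
    qed
    moreover have "nbr (\<pi> (x i)) ((k i + 1) mod d) \<noteq> dir (\<pi> (x i)) (c (x i))"
      using good(3)[OF i] noloop[OF i] turn_xk[of i] \<pi>_pt[OF xn] by (auto simp: Tow_def turn_def c_def)
    ultimately show "s \<le> dd (x i) (c (x i)) \<and> dd (x i) (c (x i)) \<le> 4 * G \<and> \<pi> (x i) \<noteq> c (x i) \<and>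
      dd (\<pi> (x i)) (c (x i)) \<le> 4 * G \<and> dir (c (x i)) (x i) \<noteq> dir (c (x i)) (\<pi> (x i)) \<and>
      nbr (x i) (k i) \<noteq> dir (x i) (c (x i)) \<and>
      nbr (\<pi> (x i)) ((k i + 1) mod d) \<noteq> dir (\<pi> (x i)) (c (x i))"
      using near M by blast
  next
    \<comment> \<open>At least half of the \<open>j\<close> positions are outside \<open>B\<close>,
      which explains the factor 2 in \<open>sj\<close>.\<close>
    have "{i. i < j \<and> x i \<notin> B} = {0..<j} - {i. i < j \<and> (\<Psi> ^^ i) \<omega> \<in> Slow}"
      using xkd by (auto simp: xk Slow_def)
    then have "card {i. i < j \<and> x i \<notin> B} = j - card {i. i < j \<and> (\<Psi> ^^ i) \<omega> \<in> Slow}"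
      by (simp add: card_Diff_subset subset_eq)
    then have "j \<le> 2 * card {i. i < j \<and> x i \<notin> B}" using \<omega>(4) by linarith
    then have "s * j \<le> 2 * (s * card {i. i < j \<and> x i \<notin> B})" using mult_le_mono2 by fastforce
    from less_le_trans[OF sj this] show "r + 1 < s * card {i. i < j \<and> x i \<notin> B}" by simp
  qed (use step xkd d2 noloop s0 rG jm Gm in auto)
  then obtain \<tau> where \<tau>: "\<tau> < j" "x \<tau> \<notin> B" "2 * G \<le> dd (x 0) (x \<tau>)" by blast
  have x0: "x 0 \<notin> B" using \<omega>(1,2) by (auto simp: x_def Slow_def)
  \<comment> \<open>Only edge steps are listed. The jump from \<open>x i\<close> to
    \<open>\<pi> (x i)\<close> stays inside a part and so vanishes under contraction.\<close>
  define mid where "mid i = map (\<lambda>i. (\<pi> (x i), x (Suc i))) [0..<i]" for i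
  have Suc_x: "x (Suc i) = nbr (\<pi> (x i)) ((k i + 1) mod d)" if "i < j" for i
    using step[of i] noloop[OF that] by (simp add: rv_def)
  have mid: "contr_walk pt (pt (x 0)) (mid i) (pt (x i)) \<and>
    walk_length l (mid i) = (\<Sum>i'<i. f ((\<Psi> ^^ i') \<omega>)) \<and>
    set (mid i) \<subseteq> {(a, b). a \<noteq> b \<and> edge_code a b \<in> XE \<union> AE}" if "i \<le> j" for i
    using that
  proof (induction i)
    case 0
    then show ?case by (simp add: mid_def)
  next
    case (Suc i)
    then have i: "i < j" by simp
    have eq: "mid (Suc i) = mid i @ [(\<pi> (x i), x (Suc i))]" by (simp add: mid_def)
    have "(\<pi> (x i), x (Suc i)) \<in> R" using nbr[OF noloop[OF i]] Suc_x[OF i] by simp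
    then have "\<pi> (x i) \<noteq> x (Suc i) \<and> edge_code (\<pi> (x i)) (x (Suc i)) \<in> XE"
      using R_neq by (force simp: XE_def)
    moreover have "f ((\<Psi> ^^ i) \<omega>) = l (edge_code (\<pi> (x i)) (x (Suc i)))"
      using noloop[OF i] Suc_x[OF i] unfolding xk f_def h_def turn_def by simp
    moreover have "contr_walk pt (pt (x i)) [(\<pi> (x i), x (Suc i))] (pt (x (Suc i)))"
      using \<pi>_pt xkd by simp
    ultimately show ?case using Suc.IH i unfolding eq by (auto intro: contr_walk_append)
  qed
  note mid = mid[of \<tau>, OF less_imp_le[OF \<tau>(1)]]
  define p where "p = up (x 0) @ mid \<tau> @ down (x \<tau>)"
  have xn: "x 0 < n" "x \<tau> < n" using xkd by auto
  have "contr_walk pt (pt (t (x 0))) p (pt (t (x \<tau>)))"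
    unfolding p_def using up(1) mid down(1) by (blast intro: contr_walk_append)
  moreover have "length p \<le> j + 2"
    using up(2)[of "x 0"] down(2)[of "x \<tau>"] \<tau>(1) by (simp add: p_def mid_def)
  moreover have "set p \<subseteq> {(a, b). a \<noteq> b \<and> edge_code a b \<in> XE \<union> AE}"
    using ends[OF xn(1)] ends[OF xn(2)] mid unfolding p_def by simp
  moreover have "G \<le> dd (t (x 0)) (t (x \<tau>))"
    using dd_triangle[of "x 0" "x \<tau>" "t (x 0)"] dd_triangle[of "t (x 0)" "x \<tau>" "t (x \<tau>)"]
      dd_sym[of "t (x \<tau>)" "x \<tau>"] t_near[OF xn(1)] t_near[OF xn(2)] Gm \<tau>(3) by linarith
  moreover have "n * d * walk_length l p \<le> 24 * Y"
  proof -
    have "walk_length l (mid \<tau>) \<le> (\<Sum>i<j. f ((\<Psi> ^^ i) \<omega>))"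
      using mid \<tau>(1) sum_mono2[of "{..<j}" "{..<\<tau>}" "\<lambda>i. f ((\<Psi> ^^ i) \<omega>)"] h0 by (simp add: f_def)
    then have "walk_length l (mid \<tau>) \<le> K" using \<omega>(5) by linarith
    then have "n * d * walk_length l (mid \<tau>) \<le> n * d * K" by (intro mult_left_mono) auto
    also have "\<dots> = 8 * Y" using n0 d2 by (simp add: K_def)
    finally show ?thesis
      using attB[OF xn(1) x0] attB[OF xn(2) \<tau>(2)] up(3) down(3) by (simp add: p_def distrib_left)
  qed
  ultimately show False using no t_T xn by blast
qed

end

section \<open>From edge lengths to demands\<close>

text \<open>Weak duality: if the metric \<open>\<delta>\<close> is dominated by edge lengths \<open>w\<close> of total volume at most \<open>W\<close>,
  each unit of demand between \<open>s\<close> and \<open>t\<close> uses up volume at least \<open>\<delta> s t\<close>.\<close>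

lemma cong_ge:
  fixes \<delta> :: "'v::linorder \<Rightarrow> 'v \<Rightarrow> real" and ends :: "'e \<Rightarrow> 'v \<times> 'v"
  assumes fin: "finite V" "finite E" and T: "T \<subseteq> V"
    and ends: "\<And>e. e \<in> E \<Longrightarrow> fst (ends e) \<in> V \<and> snd (ends e) \<in> V"
    and lip: "\<And>s e. e \<in> E \<Longrightarrow> \<bar>\<delta> s (fst (ends e)) - \<delta> s (snd (ends e))\<bar> \<le> w e"
    and \<delta>0: "\<And>s. \<delta> s s = 0" and vol: "(\<Sum>e\<in>E. cap e * w e) \<le> W" "0 < W"
    and M: "M \<le> (\<Sum>k\<in>term_pairs T. D (fst k) (snd k) * \<delta> (fst k) (snd k))"
  shows "ereal (M / W) \<le> cong V E ends cap id T D"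
  unfolding cong_def
proof (rule Inf_greatest)
  fix z assume "z \<in> {ereal c |c. 0 \<le> c \<and> (\<exists>g. routes V E ends id T D g \<and>
    (\<forall>e\<in>E. (\<Sum>k\<in>term_pairs T. \<bar>g k e\<bar>) \<le> c * cap e))}"
  then obtain c g where z: "z = ereal c" and c: "0 \<le> c" and g: "routes V E ends id T D g"
    and load: "\<And>e. e \<in> E \<Longrightarrow> (\<Sum>k\<in>term_pairs T. \<bar>g k e\<bar>) \<le> c * cap e" by blast
  have w0: "0 \<le> w e" if "e \<in> E" for e using lip[OF that] by (meson abs_ge_zero order_trans)
  have "D (fst k) (snd k) * \<delta> (fst k) (snd k) \<le> (\<Sum>e\<in>E. \<bar>g k e\<bar> * w e)" if k: "k \<in> term_pairs T" for k
  proof -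
    obtain s t where st: "k = (s, t)" "s \<in> V" "t \<in> V" "s \<noteq> t" using k T by (auto simp: term_pairs_def)
    define net where "net x = (\<Sum>e\<in>{e \<in> E. fst (ends e) = x}. g k e) - (\<Sum>e\<in>{e \<in> E. snd (ends e) = x}. g k e)" for x
    have net: "net x = (if x = s then D s t else if x = t then - D s t else 0)" if "x \<in> V" for x
      using g k that unfolding routes_def net_def st(1) by simp
    \<comment> \<open>With \<open>\<delta> s\<close> as a potential the source contributes nothing,
      so only the term of the sink remains. Summation by parts then turns the potential into
      differences along edges.\<close>
    have "(\<Sum>x\<in>V. \<delta> s x * net x) = (\<Sum>x\<in>V. (if x = t then - (D s t * \<delta> s t) else 0))"
      using st net \<delta>0 by (intro sum.cong) auto
    also have "\<dots> = - (D s t * \<delta> s t)" using fin st by simp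
    finally have 1: "D s t * \<delta> s t = - (\<Sum>x\<in>V. \<delta> s x * net x)" by simp
    have "(\<Sum>x\<in>V. \<delta> s x * net x) = (\<Sum>x\<in>V. \<Sum>e\<in>{e \<in> E. fst (ends e) = x}. \<delta> s (fst (ends e)) * g k e)
        - (\<Sum>x\<in>V. \<Sum>e\<in>{e \<in> E. snd (ends e) = x}. \<delta> s (snd (ends e)) * g k e)"
      unfolding net_def right_diff_distrib sum_subtractf sum_distrib_left by simp
    also have "\<dots> = (\<Sum>e\<in>E. \<delta> s (fst (ends e)) * g k e) - (\<Sum>e\<in>E. \<delta> s (snd (ends e)) * g k e)"
      using sum.group[OF fin(2,1), of "\<lambda>e. fst (ends e)" "\<lambda>e. \<delta> s (fst (ends e)) * g k e"]
        sum.group[OF fin(2,1), of "\<lambda>e. snd (ends e)" "\<lambda>e. \<delta> s (snd (ends e)) * g k e"] ends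
      by (auto simp: image_subset_iff)
    also have "\<dots> = (\<Sum>e\<in>E. g k e * (\<delta> s (fst (ends e)) - \<delta> s (snd (ends e))))"
      unfolding sum_subtractf[symmetric] by (rule sum.cong) (simp_all add: algebra_simps)
    finally have 2: "(\<Sum>x\<in>V. \<delta> s x * net x) = (\<Sum>e\<in>E. g k e * (\<delta> s (fst (ends e)) - \<delta> s (snd (ends e))))" .
    have "D s t * \<delta> s t \<le> \<bar>\<Sum>e\<in>E. g k e * (\<delta> s (fst (ends e)) - \<delta> s (snd (ends e)))\<bar>"
      using 1 2 by linarith
    also have "\<dots> \<le> (\<Sum>e\<in>E. \<bar>g k e * (\<delta> s (fst (ends e)) - \<delta> s (snd (ends e)))\<bar>)" by (rule sum_abs)
    also have "\<dots> \<le> (\<Sum>e\<in>E. \<bar>g k e\<bar> * w e)"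
      using lip by (intro sum_mono) (simp add: abs_mult mult_left_mono)
    finally show ?thesis using st by simp
  qed
  then have "(\<Sum>k\<in>term_pairs T. D (fst k) (snd k) * \<delta> (fst k) (snd k)) \<le>
      (\<Sum>k\<in>term_pairs T. \<Sum>e\<in>E. \<bar>g k e\<bar> * w e)" by (rule sum_mono)
  with M have "M \<le> (\<Sum>k\<in>term_pairs T. \<Sum>e\<in>E. \<bar>g k e\<bar> * w e)" by (rule order_trans)
  also have "\<dots> = (\<Sum>e\<in>E. (\<Sum>k\<in>term_pairs T. \<bar>g k e\<bar>) * w e)"
    by (subst sum.swap) (simp add: sum_distrib_right)
  also have "\<dots> \<le> (\<Sum>e\<in>E. c * cap e * w e)"
    using load w0 by (intro sum_mono mult_right_mono) auto
  also have "\<dots> = c * (\<Sum>e\<in>E. cap e * w e)" by (simp add: sum_distrib_left mult.assoc)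
  also have "\<dots> \<le> c * W" using c vol by (intro mult_left_mono) auto
  finally show "ereal (M / W) \<le> z" using z vol(2) by (simp add: divide_le_eq)
qed

section \<open>Upper bounds on congestion by flows along walks\<close>

lemma cong_le:
  assumes "routes W E ends loc T D g" "0 \<le> c" "\<And>e. e \<in> E \<Longrightarrow> (\<Sum>k\<in>term_pairs T. \<bar>g k e\<bar>) \<le> c * cap e"
  shows "cong W E ends cap loc T D \<le> ereal c"
  unfolding cong_def using assms by (intro Inf_lower) blast

text \<open>The sign refers to the orientation from the smaller to the larger end, which is that of
  \<open>prod_decode\<close>.\<close>

definition dart_flow :: "nat \<times> nat \<Rightarrow> nat \<Rightarrow> real" where
  "dart_flow a e = (if e = edge_code (fst a) (snd a) then if fst a < snd a then 1 else -1 else 0)"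

definition walk_flow :: "(nat \<times> nat) list \<Rightarrow> nat \<Rightarrow> real" where
  "walk_flow p e = (\<Sum>a\<leftarrow>p. dart_flow a e)"

definition uses :: "(nat \<times> nat) list \<Rightarrow> nat \<Rightarrow> real" where
  "uses p e = (\<Sum>a\<leftarrow>p. of_bool (e = edge_code (fst a) (snd a)))"

lemma abs_walk_flow_le: "\<bar>walk_flow p e\<bar> \<le> uses p e"
proof (induction p)
  case (Cons a p)
  then show ?case using abs_triangle_ineq[of "dart_flow a e" "walk_flow p e"]
    by (auto simp: walk_flow_def uses_def dart_flow_def)
qed (simp add: walk_flow_def uses_def)

lemma walk_length_uses:
  assumes "finite E" "set p \<subseteq> {(a, b). a \<noteq> b \<and> edge_code a b \<in> E}"
  shows "walk_length l p = (\<Sum>e\<in>E. l e * uses p e)"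
  using assms
proof (induction p)
  case (Cons a p)
  obtain u v where a: "a = (u, v)" by fastforce
  have "(\<Sum>e\<in>E. l e * uses (a # p) e) =
      (\<Sum>e\<in>E. if e = edge_code u v then l e else 0) + (\<Sum>e\<in>E. l e * uses p e)"
    unfolding sum.distrib[symmetric] by (rule sum.cong) (auto simp: uses_def a distrib_left)
  then show ?case using Cons a by simp
qed (simp add: uses_def)

text \<open>For an edge inside a part both sides vanish: the edge is absent from the contracted
  graph and its two nodes coincide. This is why \<open>contr_walk\<close> may contain such
  edges.\<close>

lemma net_dart_flow:
  assumes ab: "a \<noteq> b" "edge_code a b \<in> E" and E: "finite E"
  shows "(\<Sum>e\<in>{e \<in> contr_edges F E prod_decode. fst (contr_ends F prod_decode e) = x}. dart_flow (a, b) e) -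
    (\<Sum>e\<in>{e \<in> contr_edges F E prod_decode. snd (contr_ends F prod_decode e) = x}. dart_flow (a, b) e) =
    of_bool (x = part F a) - of_bool (x = part F b)"
proof -
  have dec: "prod_decode (edge_code a b) = (min a b, max a b)" by (simp add: edge_code_def)
  have *: "(\<Sum>e\<in>S. dart_flow (a, b) e) = (if edge_code a b \<in> S then if a < b then 1 else -1 else 0)" if "finite S" for S
    unfolding dart_flow_def using that by simp
  have fin: "finite {e \<in> contr_edges F E prod_decode. P e}" for P
    using E by (rule rev_finite_subset) (auto simp: contr_edges_def)
  show ?thesis
    unfolding *[OF fin] using ab by (cases "a < b") (auto simp: contr_edges_def contr_ends_def dec)
qed

lemma net_walk_flow:
  assumes "contr_walk (part F) P p Q" "set p \<subseteq> {(a, b). a \<noteq> b \<and> edge_code a b \<in> E}" and E: "finite E"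
  shows "(\<Sum>e\<in>{e \<in> contr_edges F E prod_decode. fst (contr_ends F prod_decode e) = x}. walk_flow p e) -
    (\<Sum>e\<in>{e \<in> contr_edges F E prod_decode. snd (contr_ends F prod_decode e) = x}. walk_flow p e) =
    of_bool (x = P) - of_bool (x = Q)"
  using assms(1,2)
proof (induction p arbitrary: P)
  case Nil
  then show ?case by (simp add: walk_flow_def)
next
  case (Cons d p)
  obtain a b where d: "d = (a, b)" by fastforce
  have IH: "contr_walk (part F) (part F b) p Q" "P = part F a" "a \<noteq> b" "edge_code a b \<in> E"
    "set p \<subseteq> {(a, b). a \<noteq> b \<and> edge_code a b \<in> E}"
    using Cons.prems d by auto
  have "walk_flow (d # p) e = dart_flow (a, b) e + walk_flow p e" for e by (simp add: walk_flow_def d)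
  then show ?case
    using Cons.IH[OF IH(1,5)] net_dart_flow[OF IH(3,4) E, of F x] IH(2) by (simp add: sum.distrib)
qed

text \<open>Of the two orders of a pair exactly one belongs to \<open>term_pairs\<close>.\<close>

lemma sum_term_pairs:
  fixes f :: "'v::linorder \<times> 'v \<Rightarrow> real"
  assumes "finite T" "u \<in> T" "v \<in> T" "u \<noteq> v"
  shows "(\<Sum>k\<in>term_pairs T. (of_bool (k = (u, v)) + of_bool (k = (v, u))) * f k) = f (min u v, max u v)"
proof -
  have fin: "finite (term_pairs T)"
    by (rule finite_subset[of _ "T \<times> T"]) (use assms in \<open>auto simp: term_pairs_def\<close>)
  have "(\<Sum>k\<in>term_pairs T. (of_bool (k = (u, v)) + of_bool (k = (v, u))) * f k) =
      (\<Sum>k\<in>term_pairs T. if k = (min u v, max u v) then f k else 0)"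
    using assms by (intro sum.cong) (auto simp: term_pairs_def min_def max_def)
  also have "\<dots> = f (min u v, max u v)"
    using fin assms by (auto simp: term_pairs_def min_def max_def)
  finally show ?thesis .
qed

lemma part_eq:
  assumes "valid_partition V T F" "x \<in> V"
  shows "part F x \<in> F \<and> x \<in> part F x"
proof -
  obtain P where "P \<in> F" "x \<in> P" using assms by (auto simp: valid_partition_def)
  moreover have "Q = P" if "Q \<in> F" "x \<in> Q" for Q
    using assms that calculation unfolding valid_partition_def by blast
  ultimately have "part F x = P" unfolding part_def by (intro the_equality) blast+
  then show ?thesis using \<open>P \<in> F\<close> \<open>x \<in> P\<close> by simp
qed

lemma part_neq:
  assumes F: "valid_partition V T F" and T: "T \<subseteq> V" "a \<in> T" "b \<in> T" and ne: "a \<noteq> b"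
  shows "part F a \<noteq> part F b"
proof
  assume eq: "part F a = part F b"
  have "a \<in> part F a" "b \<in> part F a" "part F a \<in> F"
    using part_eq[OF F subsetD[OF T(1) T(2)]] part_eq[OF F subsetD[OF T(1) T(3)]] unfolding eq by blast+
  moreover have "\<forall>a\<in>T. \<forall>b\<in>T. a \<noteq> b \<longrightarrow> \<not> (\<exists>P\<in>F. a \<in> P \<and> b \<in> P)"
    using F unfolding valid_partition_def by (elim conjE)
  from this[rule_format, OF T(2,3) ne] have "\<not> (\<exists>P\<in>F. a \<in> P \<and> b \<in> P)" .
  ultimately show False by meson
qed

section \<open>The demand that separates the two congestions\<close>

context attached_graph
begin

lemma edge_ends:
  assumes "edge_code a b \<in> XE \<union> AE"
  shows "a < n \<and> b < n \<and> a \<noteq> b"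
proof -
  have "\<exists>u v. edge_code a b = edge_code u v \<and> u < n \<and> v < n \<and> u \<noteq> v"
    using assms
  proof
    assume "edge_code a b \<in> XE"
    then obtain u v where "(u, v) \<in> R" "edge_code a b = edge_code u v" by (auto simp: XE_def)
    then show ?thesis using R_less R_neq by blast
  next
    assume "edge_code a b \<in> AE"
    then obtain v where "v < n" "t v \<noteq> v" "edge_code a b = edge_code v (t v)" by (auto simp: AE_def)
    moreover have "t v < n" using t_T[OF \<open>v < n\<close>] T by auto
    ultimately show ?thesis by metis
  qed
  then show ?thesis by (auto simp: edge_code_eq)
qed

lemma XE_AE_E: "e \<in> XE \<union> AE \<Longrightarrow> \<exists>a b. e = edge_code a b \<and> prod_decode e = (a, b) \<and> a < b \<and> b < n"
proof -
  assume e: "e \<in> XE \<union> AE"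
  then obtain u v where uv: "e = edge_code u v" by (auto simp: XE_def AE_def)
  then have "u < n" "v < n" "u \<noteq> v" using edge_ends e by auto
  then show ?thesis
    by (intro exI[of _ "min u v"] exI[of _ "max u v"]) (auto simp: uv edge_code_def)
qed

lemma simple: "simple_cap_graph {0..<n} (XE \<union> AE) prod_decode cap"
  unfolding simple_cap_graph_def
proof (intro conjI ballI)
  show "inj_on prod_decode (XE \<union> AE)" by (rule inj_prod_decode)
  fix e assume e: "e \<in> XE \<union> AE"
  show "1 \<le> cap e" using e m0 d2 by (auto simp: cap_def)
qed (use finXE finAE XE_AE_E in force)+

text \<open>At most \<open>n * d / 2\<close> edges have length 1 and capacity \<open>2 * m\<close>,
  and at most \<open>n\<close> attachment edges have length at most \<open>2 * m\<close> and
  capacity \<open>d\<close>. Together this is at most \<open>3 * m * n * d\<close>.\<close>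

lemma volume:
  "(\<Sum>e\<in>XE \<union> AE. cap e * dd (fst (prod_decode e)) (snd (prod_decode e))) \<le> 4 * m * n * d"
proof -
  define f where "f e = real (dd (fst (prod_decode e)) (snd (prod_decode e)))" for e
  have f: "f (edge_code u v) = dd u v" for u v
    by (auto simp: f_def edge_code_def min_def max_def dd_sym)
  have "2 * sum f XE = (\<Sum>(u, v)\<in>R. f (edge_code u v))" by (rule sum_R[symmetric])
  also have "\<dots> = (\<Sum>a\<in>R. 1)" by (rule sum.cong) (auto simp: f dd_edge)
  also have "\<dots> = card (SIGMA u:{0..<n}. R `` {u})"
    using R_sub by (simp, intro arg_cong[of _ _ card]) auto
  also have "\<dots> = (\<Sum>u\<in>{0..<n}. card (R `` {u}))" using finR by (subst card_SigmaI) auto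
  also have "\<dots> \<le> (\<Sum>u\<in>{0..<n}. d)" unfolding of_nat_le_iff by (intro sum_mono deg)
  finally have X: "2 * sum f XE \<le> n * d" by (simp flip: of_nat_mult)
  have "sum f AE = (\<Sum>v\<in>{v. v < n \<and> t v \<noteq> v}. f (edge_code v (t v)))" by (rule sum_AE[symmetric])
  also have "\<dots> \<le> (\<Sum>v\<in>{v. v < n \<and> t v \<noteq> v}. 2 * m)"
    unfolding of_nat_sum using t_near by (intro sum_mono) (auto simp: f simp del: of_nat_mult)
  also have "\<dots> \<le> (\<Sum>v\<in>{0..<n}. 2 * m)"
    unfolding of_nat_le_iff by (intro sum_mono2) auto
  finally have A: "sum f AE \<le> n * (2 * m)" by simp
  have "(\<Sum>e\<in>XE \<union> AE. cap e * f e) = m * (2 * sum f XE) + d * sum f AE" unfolding sum_cap by simp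
  also have "\<dots> \<le> m * (n * d) + d * (n * (2 * m))"
    using X A unfolding of_nat_add of_nat_mult by (intro add_mono mult_left_mono) auto
  also have "\<dots> \<le> 4 * m * n * d" by (simp add: mult_ac)
  finally show ?thesis by (simp add: f_def)
qed

text \<open>\<open>short_contr_walk\<close> rules out the covering side of the alternative, so a
  fractional packing of walks between far terminals exists. It defines both the demand and its
  routing in the contracted graph. Total demand \<open>n * d / 24\<close> at distance at least
  \<open>G\<close>, against volume \<open>4 * m * n * d\<close>, gives the 96.\<close>

lemma ex_bad_demand:
  fixes F :: "nat set set" and G j s :: nat
  assumes F: "valid_partition {0..<n} T F"
    and Gm: "4 * m \<le> G" and jm: "j \<le> m" and j0: "0 < j" and rG: "r = 12 * G" and s0: "0 < s" "s \<le> r"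
    and sj: "2 * (r + 1) < s * j"
    and few: "2 * j * (card F * ((d + 1) ^ s + 1) * d + 2 * n + card deficient * d) < n * d"
  shows "\<exists>D. is_demand T D \<and>
    ereal (real G / (96 * real m)) \<le> cong {0..<n} (XE \<union> AE) prod_decode cap id T D \<and>
    cong F (contr_edges F (XE \<union> AE) prod_decode) (contr_ends F prod_decode) cap (part F) T D \<le> ereal 2"
proof -
  define E where "E = XE \<union> AE"
  have finE: "finite E" using finXE finAE by (simp add: E_def)
  have finT: "finite T" using T finite_subset by blast
  have n0: "0 < n" using few by (cases n) auto
  have nd: "0 < real n * real d" using n0 d2 by simp
  have G0: "0 < G" using Gm m0 by simp
  have finF: "finite F"
    using F by (intro finite_subset[of F "Pow {0..<n}"]) (auto simp: valid_partition_def)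
  have "part F ` {0..<n} \<subseteq> F" using part_eq[OF F] by blast
  then have "card (part F ` {0..<n}) \<le> card F" by (rule card_mono[OF finF])
  then have "2 * j * (card (part F ` {0..<n}) * ((d + 1) ^ s + 1) * d + 2 * n + card deficient * d)
      \<le> 2 * j * (card F * ((d + 1) ^ s + 1) * d + 2 * n + card deficient * d)"
    by (intro mult_le_mono2 add_le_mono mult_le_mono order_refl)
  then have few': "2 * j * (card (part F ` {0..<n}) * ((d + 1) ^ s + 1) * d + 2 * n + card deficient * d) < n * d"
    using few by (rule le_less_trans)
  \<comment> \<open>The bound on the length of the walks keeps this index set finite.\<close>
  define I where "I = {(u, v, p). u \<in> T \<and> v \<in> T \<and> G \<le> dd u v \<and> contr_walk (part F) (part F u) p (part F v) \<and>
    length p \<le> j + 2 \<and> set p \<subseteq> {(a, b). a \<noteq> b \<and> edge_code a b \<in> E}}"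
  have finI: "finite I"
  proof (rule finite_subset)
    show "I \<subseteq> T \<times> T \<times> {p. set p \<subseteq> {0..<n} \<times> {0..<n} \<and> length p \<le> j + 2}"
      using edge_ends by (fastforce simp: I_def E_def)
    show "finite (T \<times> T \<times> {p. set p \<subseteq> {0..<n} \<times> {0..<n} \<and> length p \<le> j + 2})"
      using finT by (intro finite_cartesian_product finite_lists_length_le) auto
  qed
  \<comment> \<open>The total demand. The 24 matches the bound in
    \<open>short_contr_walk\<close>.\<close>
  define lam where "lam = real n * real d / 24"
  have lam: "0 < lam" using nd by (simp add: lam_def)
  define A where "A i e = (case i of (u, v, p) \<Rightarrow> lam * uses p e / cap e)" for i :: "nat \<times> nat \<times> (nat \<times> nat) list" and e
  have cap1: "1 \<le> cap e" if "e \<in> E" for e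
    using simple that by (simp add: simple_cap_graph_def E_def)
  have no_lengths: False if y: "\<forall>e\<in>E. 0 \<le> y e" "0 < sum y E" "\<forall>i\<in>I. sum y E < (\<Sum>e\<in>E. y e * A i e)" for y
  proof -
    \<comment> \<open>Dividing by capacities turns a covering solution into edge lengths whose
      volume is \<open>sum y E\<close>.\<close>
    define l where "l e = (if e \<in> E then y e / cap e else 0)" for e
    have cl: "cap e * l e = y e" if "e \<in> E" for e using cap1[OF that] that by (simp add: l_def)
    then have Y: "(\<Sum>e\<in>XE \<union> AE. cap e * l e) = sum y E" unfolding E_def[symmetric] by (intro sum.cong) auto
    have l0: "0 \<le> l e" for e using y(1) cap1[of e] by (auto simp: l_def intro!: divide_nonneg_nonneg)
    have Y0: "0 < (\<Sum>e\<in>XE \<union> AE. cap e * l e)" using Y y(2) by simp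
    obtain u v p where p: "u \<in> T" "v \<in> T" "G \<le> dd u v" "contr_walk (part F) (part F u) p (part F v)"
      "length p \<le> j + 2" "set p \<subseteq> {(a, b). a \<noteq> b \<and> edge_code a b \<in> E}"
      "n * d * walk_length l p \<le> 24 * sum y E"
      using short_contr_walk[OF l0 Y0 Gm jm j0 rG s0 sj few'] unfolding Y unfolding E_def[symmetric] by blast
    have "(u, v, p) \<in> I" using p by (simp add: I_def)
    then have "sum y E < (\<Sum>e\<in>E. y e * A (u, v, p) e)" using y(3) by blast
    also have "\<dots> = lam * (\<Sum>e\<in>E. l e * uses p e)"
      unfolding sum_distrib_left by (rule sum.cong) (auto simp: A_def l_def)
    also have "\<dots> = lam * walk_length l p" using walk_length_uses[OF finE p(6)] by simp
    also have "\<dots> \<le> sum y E" using p(7) by (simp add: lam_def)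
    finally show False by simp
  qed
  \<comment> \<open>Without edges every vertex is deficient, which contradicts
    \<open>few\<close>.\<close>
  have E0: "E \<noteq> {}"
  proof
    assume E: "E = {}"
    have "R = {}" using E by (auto simp: E_def XE_def)
    then have "deficient = {0..<n}" unfolding deficient_def using d2 by auto
    then have "card deficient * d = n * d" by simp
    moreover have "card deficient * d \<le> 2 * j * (card F * ((d + 1) ^ s + 1) * d + 2 * n + card deficient * d)"
      using j0 by (cases j) auto
    ultimately show False using few by linarith
  qed
  obtain w where w: "\<And>i. i \<in> I \<Longrightarrow> 0 \<le> w i" "sum w I = 1" "\<And>e. e \<in> E \<Longrightarrow> (\<Sum>i\<in>I. w i * A i e) \<le> 2"
    using packing_covering_alternative[OF finI finE E0, of A] no_lengths by blast
  define src where "src i = fst i" for i :: "nat \<times> nat \<times> (nat \<times> nat) list"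
  define dst where "dst i = fst (snd i)" for i :: "nat \<times> nat \<times> (nat \<times> nat) list"
  define pth where "pth i = snd (snd i)" for i :: "nat \<times> nat \<times> (nat \<times> nat) list"
  have I: "src i \<in> T" "dst i \<in> T" "src i \<noteq> dst i" "G \<le> dd (src i) (dst i)"
    "contr_walk (part F) (part F (src i)) (pth i) (part F (dst i))"
    "set (pth i) \<subseteq> {(a, b). a \<noteq> b \<and> edge_code a b \<in> E}" if "i \<in> I" for i
    using that G0 by (auto simp: I_def src_def dst_def pth_def)
  \<comment> \<open>\<open>term_pairs\<close> lists pairs in increasing order, whereas a walk may
    run either way. Reversed walks count positively in \<open>D\<close> and with the opposite sign
    in \<open>g\<close>.\<close>
  define same where "same i k = (of_bool (k = (src i, dst i)) :: real)" for i k
  define opp where "opp i k = (of_bool (k = (dst i, src i)) :: real)" for i k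
  define D where "D a b = lam * (\<Sum>i\<in>I. w i * (same i (a, b) + opp i (a, b)))" for a b
  define g where "g k e = lam * (\<Sum>i\<in>I. w i * ((same i k - opp i k) * walk_flow (pth i) e))" for k e
  have D0: "0 \<le> D a b" for a b
    unfolding D_def using w(1) lam by (intro mult_nonneg_nonneg sum_nonneg) (auto simp: same_def opp_def)
  have "is_demand T D"
    unfolding is_demand_def
  proof (intro conjI allI impI)
    fix a b
    show "0 \<le> D a b" by (rule D0)
    have "same i (a, b) = opp i (b, a)" "same i (b, a) = opp i (a, b)" for i
      by (auto simp: same_def opp_def)
    then show "D a b = D b a" unfolding D_def by (simp add: add.commute)
    have "\<exists>i\<in>I. (a, b) = (src i, dst i) \<or> (a, b) = (dst i, src i)" if "D a b \<noteq> 0"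
    proof (rule ccontr)
      assume "\<not> ?thesis"
      then have "same i (a, b) = 0 \<and> opp i (a, b) = 0" if "i \<in> I" for i
        using that by (auto simp: same_def opp_def)
      then have "D a b = 0" by (simp add: D_def)
      then show False using that by simp
    qed
    then have "a \<in> T \<and> b \<in> T \<and> a \<noteq> b" if "D a b \<noteq> 0"
      using that I(1-3) by (metis Pair_inject)
    then show "a \<in> T" "b \<in> T" "a \<noteq> b" if "D a b \<noteq> 0" using that by auto
  next
    obtain i where i: "i \<in> I" "w i \<noteq> 0" using w(2) by (metis sum.neutral zero_neq_one)
    then have "0 < w i" using w(1) by fastforce
    also have "w i \<le> (\<Sum>i'\<in>I. w i' * (same i' (src i, dst i) + opp i' (src i, dst i)))"
      using member_le_sum[of i I "\<lambda>i'. w i' * (same i' (src i, dst i) + opp i' (src i, dst i))"] finI w(1) i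
        I(3)[OF i(1)] by (simp add: same_def opp_def)
    finally have "0 < D (src i) (dst i)" using lam by (simp add: D_def)
    then show "\<exists>a b. 0 < D a b" by blast
  qed
  moreover have "ereal (real G / (96 * real m)) \<le> cong {0..<n} E prod_decode cap id T D"
  proof -
    have "lam * real G = lam * (\<Sum>i\<in>I. w i * G)" by (simp add: w(2) flip: sum_distrib_right)
    also have "\<dots> \<le> lam * (\<Sum>i\<in>I. w i * (\<Sum>k\<in>term_pairs T. (same i k + opp i k) * dd (fst k) (snd k)))"
    proof (intro mult_left_mono sum_mono)
      fix i assume i: "i \<in> I"
      have "(\<Sum>k\<in>term_pairs T. (same i k + opp i k) * real (dd (fst k) (snd k))) = dd (src i) (dst i)"
        unfolding same_def opp_def
        by (subst sum_term_pairs[OF finT I(1,2,3)[OF i]]) (auto simp: min_def max_def dd_sym)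
      then show "real G \<le> (\<Sum>k\<in>term_pairs T. (same i k + opp i k) * real (dd (fst k) (snd k)))"
        using I(4)[OF i] by simp
    qed (use w(1) lam in auto)
    also have "\<dots> = (\<Sum>k\<in>term_pairs T. D (fst k) (snd k) * dd (fst k) (snd k))"
      unfolding D_def sum_distrib_left sum_distrib_right
      by (subst sum.swap) (simp add: mult_ac)
    finally have M: "lam * real G \<le> (\<Sum>k\<in>term_pairs T. D (fst k) (snd k) * dd (fst k) (snd k))" .
    have "ereal (lam * G / (4 * m * n * d)) \<le> cong {0..<n} E prod_decode cap id T D"
    proof (rule cong_ge[OF _ finE T])
      show "fst (prod_decode e) \<in> {0..<n} \<and> snd (prod_decode e) \<in> {0..<n}" if "e \<in> E" for e
        using XE_AE_E[of e] that by (auto simp: E_def)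
      show "\<bar>real (dd a (fst (prod_decode e))) - real (dd a (snd (prod_decode e)))\<bar> \<le>
          real (dd (fst (prod_decode e)) (snd (prod_decode e)))" for a e
        using dd_triangle[of a "fst (prod_decode e)" "snd (prod_decode e)"]
          dd_triangle[of a "snd (prod_decode e)" "fst (prod_decode e)"]
          dd_sym[of "snd (prod_decode e)" "fst (prod_decode e)"] by linarith
      show "(\<Sum>e\<in>E. cap e * real (dd (fst (prod_decode e)) (snd (prod_decode e)))) \<le> real (4 * m * n * d)"
        unfolding E_def by (rule volume)
      show "0 < real (4 * m * n * d)" using n0 d2 m0 by simp
    qed (use M in auto)
    moreover have "lam * G / (4 * m * n * d) = real G / (96 * real m)" using n0 d2 by (simp add: lam_def)
    ultimately show ?thesis by simp
  qed
  moreover have "cong F (contr_edges F E prod_decode) (contr_ends F prod_decode) cap (part F) T D \<le> ereal 2"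
  proof (rule cong_le[where g = g])
    show "routes F (contr_edges F E prod_decode) (contr_ends F prod_decode) (part F) T D g"
      unfolding routes_def
    proof (intro ballI)
      fix k x assume k: "k \<in> term_pairs T" and x: "x \<in> F"
      obtain a b where ab: "k = (a, b)" "a \<in> T" "b \<in> T" "a < b" using k by (auto simp: term_pairs_def)
      define net where "net h = (\<Sum>e\<in>{e \<in> contr_edges F E prod_decode. fst (contr_ends F prod_decode e) = x}. h e) -
        (\<Sum>e\<in>{e \<in> contr_edges F E prod_decode. snd (contr_ends F prod_decode e) = x}. h e)" for h :: "nat \<Rightarrow> real"
      have net_sum: "net (\<lambda>e. lam * (\<Sum>i\<in>I. w i * (f i * h i e))) = lam * (\<Sum>i\<in>I. w i * (f i * net (h i)))" for f h
      proof -
        have "(\<Sum>e\<in>S. lam * (\<Sum>i\<in>I. w i * (f i * h i e))) = lam * (\<Sum>i\<in>I. w i * (f i * (\<Sum>e\<in>S. h i e)))" for S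
          unfolding sum_distrib_left by (rule sum.swap)
        then show ?thesis unfolding net_def right_diff_distrib sum_subtractf by (simp only:)
      qed
      have ends: "part F a \<noteq> part F b" using part_neq[OF F T ab(2,3)] ab(4) by simp
      have "net (g k) = lam * (\<Sum>i\<in>I. w i * ((same i k - opp i k) * net (walk_flow (pth i))))"
        unfolding g_def by (rule net_sum)
      also have "\<dots> = lam * (\<Sum>i\<in>I. w i * ((same i k + opp i k) * (of_bool (x = part F a) - of_bool (x = part F b))))"
      proof (intro arg_cong[of _ _ "\<lambda>x. lam * x"] sum.cong refl)
        fix i assume i: "i \<in> I"
        have "net (walk_flow (pth i)) = of_bool (x = part F (src i)) - of_bool (x = part F (dst i))"
          unfolding net_def by (rule net_walk_flow[OF I(5)[OF i] I(6)[OF i] finE])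
        then show "w i * ((same i k - opp i k) * net (walk_flow (pth i))) =
            w i * ((same i k + opp i k) * (of_bool (x = part F a) - of_bool (x = part F b)))"
          using I(3)[OF i] by (auto simp: same_def opp_def ab)
      qed
      also have "\<dots> = D a b * (of_bool (x = part F a) - of_bool (x = part F b))"
        unfolding D_def ab by (simp add: sum_distrib_right mult.assoc)
      also have "\<dots> = (if x = part F (fst k) then D (fst k) (snd k)
          else if x = part F (snd k) then - D (fst k) (snd k) else 0)"
        using ends by (auto simp: ab)
      finally show "(\<Sum>e\<in>{e \<in> contr_edges F E prod_decode. fst (contr_ends F prod_decode e) = x}. g k e) -
        (\<Sum>e\<in>{e \<in> contr_edges F E prod_decode. snd (contr_ends F prod_decode e) = x}. g k e) =
        (if x = part F (fst k) then D (fst k) (snd k)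
          else if x = part F (snd k) then - D (fst k) (snd k) else 0)"
        unfolding net_def .
    qed
    fix e assume "e \<in> contr_edges F E prod_decode"
    then have e: "e \<in> E" by (simp add: contr_edges_def)
    have "(\<Sum>k\<in>term_pairs T. \<bar>g k e\<bar>) \<le> (\<Sum>k\<in>term_pairs T. lam * (\<Sum>i\<in>I. w i * ((same i k + opp i k) * uses (pth i) e)))"
    proof (rule sum_mono)
      fix k
      have "\<bar>g k e\<bar> = lam * \<bar>\<Sum>i\<in>I. w i * ((same i k - opp i k) * walk_flow (pth i) e)\<bar>"
        using lam by (simp add: g_def abs_mult)
      also have "\<dots> \<le> lam * (\<Sum>i\<in>I. \<bar>w i * ((same i k - opp i k) * walk_flow (pth i) e)\<bar>)"
        using lam by (intro mult_left_mono sum_abs) auto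
      also have "\<dots> \<le> lam * (\<Sum>i\<in>I. w i * ((same i k + opp i k) * uses (pth i) e))"
      proof (intro mult_left_mono sum_mono)
        fix i assume i: "i \<in> I"
        show "\<bar>w i * ((same i k - opp i k) * walk_flow (pth i) e)\<bar> \<le> w i * ((same i k + opp i k) * uses (pth i) e)"
          unfolding abs_mult using w(1)[OF i] abs_walk_flow_le[of "pth i" e]
          by (intro mult_mono) (auto simp: same_def opp_def)
      qed (use lam in auto)
      finally show "\<bar>g k e\<bar> \<le> lam * (\<Sum>i\<in>I. w i * ((same i k + opp i k) * uses (pth i) e))" .
    qed
    also have "\<dots> = lam * (\<Sum>i\<in>I. w i * (\<Sum>k\<in>term_pairs T. (same i k + opp i k) * uses (pth i) e))"
      unfolding sum_distrib_left by (rule sum.swap)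
    also have "\<dots> = lam * (\<Sum>i\<in>I. w i * uses (pth i) e)"
      unfolding same_def opp_def using sum_term_pairs[OF finT I(1,2,3)]
      by (intro arg_cong[of _ _ "\<lambda>x. lam * x"] sum.cong) auto
    also have "\<dots> = cap e * (\<Sum>i\<in>I. w i * A i e)"
      unfolding sum_distrib_left using cap1[OF e]
      by (intro sum.cong) (auto simp: A_def pth_def split: prod.splits)
    also have "\<dots> \<le> cap e * 2" using w(3)[OF e] cap1[OF e] by (intro mult_left_mono) auto
    finally show "(\<Sum>k\<in>term_pairs T. \<bar>g k e\<bar>) \<le> 2 * cap e" by simp
  qed simp
  ultimately show ?thesis unfolding E_def by blast
qed

end

section \<open>Choice of parameters\<close>

lemma nat_ceiling_bounds: "0 \<le> x \<Longrightarrow> x \<le> real (nat \<lceil>x\<rceil>) \<and> real (nat \<lceil>x\<rceil>) \<le> x + 1"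
  using ceiling_correct[of x] by (simp add: of_nat_nat)

lemma nat_floor_bounds: "0 \<le> x \<Longrightarrow> real (nat \<lfloor>x\<rfloor>) \<le> x \<and> x - 1 \<le> real (nat \<lfloor>x\<rfloor>)"
  using floor_correct[of x] by (simp add: of_nat_nat)

text \<open>The degree is \<open>d\<close>, each vertex is within \<open>2 m\<close> of its terminal, the demand is between terminals at
  distance at least \<open>G\<close>, and a trajectory makes \<open>j\<close> steps with jumps of length at least \<open>s\<close>. The bound
  on \<open>D\<close> is the bound on the number of vertices of deficient degree.\<close>

definition good_parameters :: "real \<Rightarrow> real \<Rightarrow> real \<Rightarrow> nat \<Rightarrow> nat \<Rightarrow> nat \<Rightarrow> nat \<Rightarrow> nat \<Rightarrow> nat \<Rightarrow> bool" where
  "good_parameters \<alpha> \<beta> C n d m G s j \<longleftrightarrow>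
    2 \<le> d \<and> 0 < m \<and> 4 * m \<le> G \<and> j \<le> m \<and> 0 < j \<and> 0 < s \<and> s \<le> 12 * G \<and>
    2 * (12 * G + 1) < s * j \<and> log 2 (real n) powr (1 - \<alpha>) / 76800 \<le> real G / (96 * real m) \<and>
    (\<forall>\<phi> D. real \<phi> \<le> C * n / 2 powr (log 2 (real n) powr \<beta>) \<longrightarrow> D \<le> (d + 1) ^ (2 * (12 * G) + 1) \<longrightarrow>
       2 * j * (\<phi> * ((d + 1) ^ s + 1) * d + 2 * n + D * d) < n * d) \<and>
    (\<forall>k D. k * (d - 1) ^ m \<le> n \<longrightarrow> D \<le> (d + 1) ^ (2 * (12 * G) + 1) \<longrightarrow>
       k + D * (d + 1) ^ m \<le> nat \<lfloor>real n / 2 powr (log 2 (real n) powr \<alpha>)\<rfloor>)"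

text \<open>With \<open>q\<close> close to \<open>log 2 x\<close>, the choices are \<open>m\<close>
  of order \<open>x powr \<alpha> / q\<close>, \<open>G\<close> about \<open>x / (100 * q)\<close>,
  \<open>s\<close> about \<open>x powr \<beta> / (2 * q)\<close> and \<open>j\<close> about
  \<open>x powr (1 - \<beta>)\<close>. The inequalities in \<open>x\<close> absorb the
  rounding.\<close>

lemma ex_parameters:
  fixes n :: nat and \<alpha> \<beta> C x :: real
  assumes x: "x = log 2 (real n)" and n0: "0 < n" and x4: "4 \<le> x" and C: "0 < C"
    and E1: "800 * (x powr \<alpha> + 3) + 500 * (log 2 x + 1) \<le> x"
    and E2: "(x powr (1 - \<beta>) + 1) * (log 2 x + 1) \<le> x powr \<alpha>"
    and E3: "100 * (log 2 x + 1) \<le> x powr \<beta>"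
    and E4: "50 * x powr \<beta> + 1200 * (log 2 x + 1) \<le> 12 * x"
    and E5: "(x powr (1 - \<beta>) + 2) * (log 2 x + 1) < 0.26 * x"
    and E6: "16 * (x powr (1 - \<beta>) + 1) \<le> x - 1"
    and E7: "16 * C * (x powr (1 - \<beta>) + 1) \<le> 2 powr (x powr \<beta> / 2)"
    and E8: "16 * x * (x powr (1 - \<beta>) + 1) \<le> 2 powr (0.76 * x)"
    and E9: "3 * x powr \<alpha> + 2 * log 2 x + 11 \<le> 0.76 * x"
    and E10: "log 2 x + 7 \<le> 2 * x powr \<alpha>"
  shows "\<exists>d m G s j. good_parameters \<alpha> \<beta> C n d m G s j"
proof -
  define a where "a = x powr \<alpha>"
  define b where "b = x powr \<beta>"
  define L where "L = log 2 x"
  have a0: "0 < a" and b0: "0 < b" using x4 by (simp_all add: a_def b_def)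
  have xb: "x powr (1 - \<beta>) = x / b" and xa: "x powr (1 - \<alpha>) = x / a"
    using x4 by (simp_all add: powr_diff a_def b_def)
  note E = E1 E2 E3 E4 E5 E6 E7 E8 E9 E10
  note E = E[folded a_def b_def L_def, unfolded xb]
  have L2: "2 \<le> L"
    unfolding L_def using x4 by (subst le_log_iff) auto
  have n2x: "real n = 2 powr x" using n0 x by simp
  have x2L: "2 powr L = x" using x4 by (simp add: L_def)
  define q where "q = nat \<lceil>L\<rceil>"
  define m where "m = nat \<lceil>(a + 3) / (real q - 1)\<rceil>"
  define G where "G = nat \<lfloor>x / (100 * real q)\<rfloor>"
  define s where "s = nat \<lfloor>b / (2 * real q)\<rfloor>"
  define j where "j = nat \<lfloor>x / b\<rfloor> + 1"
  \<comment> \<open>Then \<open>d + 1\<close> is a power of two, which turns ball sizes into powers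
    of two with exponents in multiples of \<open>q\<close>.\<close>
  define d where "d = (2::nat) ^ q - 1"
  have q: "L \<le> q" "real q \<le> L + 1" using nat_ceiling_bounds[of L] L2 by (auto simp: q_def)
  have q2: "2 \<le> real q" using q L2 by linarith
  have q1: "real q \<le> 2 * (real q - 1)" using q2 by simp
  have m: "(a + 3) / (real q - 1) \<le> m" "real m \<le> (a + 3) / (real q - 1) + 1"
    using nat_ceiling_bounds[of "(a + 3) / (real q - 1)"] a0 q2 by (auto simp: m_def)
  have m': "real m \<le> 2 * (a + 3) / q + 1"
  proof -
    have "(a + 3) / (real q - 1) \<le> (a + 3) / (real q / 2)"
      using q2 q1 a0 by (intro divide_left_mono) auto
    then show ?thesis using m(2) by (simp add: mult.commute)
  qed
  have qm: "a + 3 \<le> (real q - 1) * m"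
    using m(1) q2 by (simp add: field_simps)
  have G: "real G \<le> x / (100 * q)" "x / (100 * q) - 1 \<le> G"
    using nat_floor_bounds[of "x / (100 * real q)"] x4 by (auto simp: G_def)
  have qG: "100 * (q * real G) \<le> x" using G(1) q2 by (simp add: field_simps)
  have s: "real s \<le> b / (2 * q)" "b / (2 * q) - 1 \<le> s"
    using nat_floor_bounds[of "b / (2 * real q)"] b0 by (auto simp: s_def)
  have qs: "q * real s \<le> b / 2" using s(1) q2 by (simp add: field_simps)
  have "0 \<le> x / b" using b0 x4 by simp
  from nat_floor_bounds[OF this] have j: "real j \<le> x / b + 1" "x / b \<le> j"
    unfolding j_def of_nat_add of_nat_1 by linarith+
  have pow2: "real (2 ^ k) = 2 powr real k" for k :: nat by (simp add: powr_realpow)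
  have d1: "d + 1 = 2 ^ q" by (simp add: d_def)
  have rd: "real d = 2 powr q - 1" using arg_cong[OF d1, of real] pow2[of q] by simp
  have xq: "x \<le> 2 powr q" "2 powr q \<le> 2 * x"
  proof -
    have "2 powr L \<le> 2 powr q" using q by simp
    then show "x \<le> 2 powr q" using x2L by simp
    have "2 powr q \<le> 2 powr (L + 1)" using q by simp
    then show "2 powr q \<le> 2 * x" using x2L by (simp add: powr_add)
  qed
  have dx: "x - 1 \<le> d" using rd xq by simp
  have C1: "2 \<le> d" using dx x4 by simp
  have C2: "0 < m" using m(1) a0 q2 by (cases "m = 0") (auto simp: divide_le_0_iff)
  have C3: "4 * m \<le> G"
  proof -
    have "800 * (a + 3) + 500 * real q \<le> x"
      using E(1) mult_left_mono[OF q(2), of 500] by simp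
    then have "(800 * (a + 3) + 500 * real q) / (100 * q) \<le> x / (100 * q)" using q2 by (intro divide_right_mono) auto
    then have "4 * (2 * (a + 3) / q + 1) \<le> x / (100 * q) - 1"
      using q2 by (simp add: add_divide_distrib)
    then have "4 * real m \<le> real G" using mult_left_mono[OF m', of 4] G(2) by linarith
    then show ?thesis by linarith
  qed
  have C4: "j \<le> m"
  proof -
    have "(x / b + 1) * real q \<le> (x / b + 1) * (L + 1)" using q x4 b0 by (intro mult_left_mono) auto
    then have "(x / b + 1) * real q \<le> a" using E(2) by linarith
    then have "x / b + 1 \<le> a / q" using q2 by (simp add: pos_le_divide_eq)
    also have "\<dots> \<le> (a + 3) / (real q - 1)" using a0 q2 by (intro frac_le) auto
    finally have "real j \<le> real m" using j(1) m(1) by linarith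
    then show ?thesis by simp
  qed
  have C5: "0 < j" by (simp add: j_def)
  have C6: "0 < s"
  proof -
    have "2 \<le> b / (2 * q)" using E(3) q q2 by (simp add: pos_le_divide_eq)
    then show ?thesis using s(2) by (cases s) auto
  qed
  have C7: "s \<le> 12 * G"
  proof -
    have "b / (2 * q) \<le> 12 * (x / (100 * q) - 1)" using E(4) q q2 by (simp add: field_simps)
    then have "real s \<le> 12 * real G" using s(1) mult_left_mono[OF G(2), of 12] by linarith
    then show ?thesis by linarith
  qed
  \<comment> \<open>Up to rounding, \<open>s * j\<close> is \<open>0.5 * x / q\<close>, while
    \<open>24 * G\<close> is at most \<open>0.24 * x / q\<close>.\<close>
  have C8: "2 * (12 * G + 1) < s * j"
  proof -
    have "(x / b + 2) * real q \<le> (x / b + 2) * (L + 1)" using q x4 b0 by (intro mult_left_mono) auto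
    then have 1: "(x / b + 2) * real q < 0.26 * x" using E(5) by linarith
    have 2: "x / b + 2 < 0.26 * x / q" using 1 q2 by (simp add: pos_less_divide_eq mult_ac)
    have "24 * real G + 2 \<le> 24 * (x / (100 * q)) + 2" using G(1) by simp
    also have "\<dots> < x / (2 * q) - x / b" using 2 by simp
    also have "\<dots> = (b / (2 * q) - 1) * (x / b)" using b0 q2 by (simp add: field_simps)
    also have "\<dots> \<le> real s * real j" using s(2) j(2) x4 b0 by (intro mult_mono) auto
    finally have "real (2 * (12 * G + 1)) < real (s * j)" by simp
    then show ?thesis by (simp only: of_nat_less_iff)
  qed
  \<comment> \<open>From \<open>x / (200 * q) \<le> G\<close> and \<open>m \<le> 4 * a / q\<close>;
    the constant is \<open>200 * 96 * 4\<close>.\<close>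
  have C9: "x powr (1 - \<alpha>) / 76800 \<le> real G / (96 * real m)"
  proof -
    have "2 \<le> x / (100 * q)" using E(1) q q2 a0 by (simp add: pos_le_divide_eq)
    then have "x / (200 * q) \<le> G" using G(2) by simp
    moreover have "real m \<le> 4 * a / q"
    proof -
      have "2 * (a + 3) + real q \<le> 4 * a" using E(10) q by simp
      then have "(2 * (a + 3) + real q) / q \<le> 4 * a / q" by (rule divide_right_mono) simp
      then have "2 * (a + 3) / q + 1 \<le> 4 * a / q" using q2 by (simp add: add_divide_distrib)
      then show ?thesis using m' by linarith
    qed
    ultimately have "(x / (200 * q)) / (96 * (4 * a / q)) \<le> real G / (96 * real m)"
      using C2 x4 by (intro frac_le) auto
    moreover have "(x / (200 * q)) / (96 * (4 * a / q)) = x / a / 76800" using q2 a0 by (simp add: field_simps)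
    ultimately show ?thesis unfolding xa by simp
  qed
  have Dbound: "real D \<le> 2 powr (0.24 * x + q)" if "D \<le> (d + 1) ^ (2 * (12 * G) + 1)" for D
  proof -
    have "real D \<le> real (2 ^ (q * (24 * G + 1)))"
    proof -
      have "2 * (12 * G) + 1 = 24 * G + 1" by simp
      then show ?thesis unfolding of_nat_le_iff using that unfolding d1 power_mult by simp
    qed
    also have "\<dots> = 2 powr real (q * (24 * G + 1))" by (rule pow2)
    also have "\<dots> \<le> 2 powr (0.24 * x + q)" using qG by (simp add: algebra_simps)
    finally show ?thesis .
  qed
  \<comment> \<open>Each of the three summands is at most a quarter of \<open>n * d\<close>. In the
    first, a ball of radius \<open>s\<close> has at most \<open>2 powr (b / 2)\<close> elements,
    which is negligible against the average part size of at least
    \<open>2 powr b / C\<close>.\<close>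
  have C10: "2 * j * (\<phi> * ((d + 1) ^ s + 1) * d + 2 * n + D * d) < n * d"
    if \<phi>: "real \<phi> \<le> C * n / 2 powr (x powr \<beta>)" and D: "D \<le> (d + 1) ^ (2 * (12 * G) + 1)" for \<phi> D
  proof -
    define J where "J = x / b + 1"
    have J: "real j \<le> J" "0 < J" using j(1) C5 by (auto simp: J_def)
    have 1: "2 * J * (\<phi> * (2 powr (q * real s) + 1)) \<le> real n / 4"
    proof -
      have "real \<phi> * (2 powr (q * real s) + 1) \<le> (C * n / 2 powr b) * (2 powr (b / 2) + 2 powr (b / 2))"
        using \<phi> qs b0 C by (intro mult_mono add_mono) (auto simp: b_def ge_one_powr_ge_zero)
      also have "\<dots> = 2 * C * n / 2 powr (b / 2)"
      proof -
        have "2 powr b = 2 powr (b / 2) * 2 powr (b / 2)" by (simp flip: powr_add)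
        then show ?thesis by (simp add: field_simps)
      qed
      finally have "2 * J * (\<phi> * (2 powr (q * real s) + 1)) \<le> 2 * J * (2 * C * n / 2 powr (b / 2))"
        using J by (intro mult_left_mono) auto
      also have "\<dots> = (16 * C * J) / 2 powr (b / 2) * (n / 4)" by simp
      also have "\<dots> \<le> 1 * (n / 4)"
        using E(7) by (intro mult_right_mono) (auto simp: J_def)
      finally show ?thesis by simp
    qed
    have 2: "2 * J * (2 * real n) \<le> real n * d / 4"
    proof -
      have "16 * J \<le> d" using E(6) dx by (simp add: J_def)
      then have "16 * J * n \<le> d * real n" by (intro mult_right_mono) auto
      then show ?thesis by (simp add: mult_ac)
    qed
    have 3: "2 * J * D \<le> real n / 4"
    proof -
      have "8 * J * D \<le> 8 * J * 2 powr (0.24 * x + q)" using Dbound[OF D] J by (intro mult_left_mono) auto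
      also have "\<dots> = 8 * J * 2 powr q * 2 powr (0.24 * x)" by (simp add: powr_add)
      also have "\<dots> \<le> 8 * J * (2 * x) * 2 powr (0.24 * x)"
        using xq(2) J by (intro mult_right_mono mult_left_mono) auto
      also have "\<dots> \<le> 2 powr (0.76 * x) * 2 powr (0.24 * x)"
        using E(8) by (intro mult_right_mono) (auto simp: J_def mult_ac)
      also have "\<dots> = real n" unfolding n2x by (simp flip: powr_add)
      finally show ?thesis by simp
    qed
    have ds: "real ((d + 1) ^ s) = 2 powr (q * real s)"
      unfolding d1 power_mult[symmetric] pow2 by simp
    have "real (2 * j * (\<phi> * ((d + 1) ^ s + 1) * d + 2 * n + D * d)) =
        2 * real j * (\<phi> * (2 powr (q * real s) + 1) * d + 2 * n + D * d)"
      unfolding ds[symmetric] by (simp add: distrib_left)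
    also have "\<dots> \<le> 2 * J * (\<phi> * (2 powr (q * real s) + 1) * d + 2 * n + D * d)"
      using J by (intro mult_right_mono) auto
    also have "\<dots> = 2 * J * (\<phi> * (2 powr (q * real s) + 1)) * d + 2 * J * (2 * n) + 2 * J * D * d"
      by (simp add: algebra_simps)
    also have "\<dots> \<le> real n / 4 * d + real n * d / 4 + real n / 4 * d"
      using 1 2 3 by (intro add_mono mult_right_mono) auto
    also have "\<dots> < real (n * d)" using n0 C1 by simp
    finally show ?thesis by (simp only: of_nat_less_iff)
  qed
  \<comment> \<open>Both summands are at most \<open>N / 8\<close>: the first because the summand 3
    in \<open>m\<close> gives \<open>(d - 1) ^ m\<close> an extra factor 8, the second because there
    are few deficient vertices. The rest of \<open>N\<close> covers rounding down.\<close>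
  have C11: "k + D * (d + 1) ^ m \<le> nat \<lfloor>real n / 2 powr (x powr \<alpha>)\<rfloor>"
    if k: "k * (d - 1) ^ m \<le> n" and D: "D \<le> (d + 1) ^ (2 * (12 * G) + 1)" for k D
  proof -
    define N where "N = real n / 2 powr a"
    have N: "N = 2 powr (x - a)" by (simp add: N_def n2x powr_diff)
    have "2 powr 1 \<le> N" unfolding N using E(9) L2 a0 x4 by (intro powr_mono) auto
    then have N2: "2 \<le> N" by simp
    have "2 powr (a + 3) \<le> real ((d - 1) ^ m)"
    proof -
      have "2 powr (a + 3) \<le> 2 powr ((real q - 1) * m)" using qm by simp
      also have "\<dots> = (2 powr (real q - 1)) ^ m" by (simp add: powr_realpow[symmetric] powr_powr)
      also have "\<dots> \<le> (real (d - 1)) ^ m"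
      proof (rule power_mono)
        have "2 powr real q = 2 powr (real q - 1) + 2 powr (real q - 1)" by (simp add: powr_diff)
        moreover have "2 powr 1 \<le> 2 powr (real q - 1)" using q2 by (intro powr_mono) auto
        ultimately show "2 powr (real q - 1) \<le> real (d - 1)" using rd C1 by (simp add: of_nat_diff)
      qed simp
      finally show ?thesis by simp
    qed
    then have "real k * 2 powr (a + 3) \<le> real k * real ((d - 1) ^ m)" by (intro mult_left_mono) auto
    also have "\<dots> \<le> real n" unfolding of_nat_mult[symmetric] of_nat_le_iff by (rule k)
    finally have "k \<le> real n / 2 powr (a + 3)" by (simp add: pos_le_divide_eq)
    also have "\<dots> = N / 8" by (simp add: N_def powr_add)
    finally have 1: "k \<le> N / 8" .
    have "real ((d + 1) ^ m) = 2 powr (q * real m)"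
      unfolding d1 power_mult[symmetric] pow2 by simp
    then have "real (D * (d + 1) ^ m) \<le> 2 powr (0.24 * x + q) * 2 powr (q * real m)"
      unfolding of_nat_mult using Dbound[OF D] by (simp add: mult_right_mono)
    also have "\<dots> = 2 powr (0.24 * x + q + q * real m)" by (simp add: powr_add)
    also have "\<dots> \<le> 2 powr (x - a - 3)"
    proof (rule powr_mono)
      have "q * real m \<le> q * (2 * (a + 3) / q + 1)" using m' by (intro mult_left_mono) auto
      also have "\<dots> = 2 * (a + 3) + q" using q2 by (simp add: field_simps)
      finally show "0.24 * x + q + q * real m \<le> x - a - 3" using E(9) q by simp
    qed simp
    also have "\<dots> = N / 8" unfolding N by (simp add: powr_diff)
    finally have 2: "real (D * (d + 1) ^ m) \<le> N / 8" .
    have "0 \<le> N" using N2 by simp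
    from conjunct2[OF nat_floor_bounds[OF this]] have "real (k + D * (d + 1) ^ m) \<le> nat \<lfloor>N\<rfloor>"
      unfolding of_nat_add using 1 2 N2 by linarith
    then show ?thesis unfolding N_def a_def of_nat_le_iff .
  qed
  have "good_parameters \<alpha> \<beta> C n d m G s j"
    unfolding good_parameters_def x[symmetric]
    by (intro conjI allI impI C1 C2 C3 C4 C5 C6 C7 C8 C9 C10 C11)
  then show ?thesis by blast
qed

text \<open>The condition \<open>1 < \<alpha> + \<beta>\<close> makes \<open>j\<close>, of order
  \<open>x powr (1 - \<beta>)\<close>, at most \<open>m\<close>, of order
  \<open>x powr \<alpha> / log 2 x\<close>. The condition \<open>\<alpha> < 1\<close> makes
  \<open>m\<close> small against \<open>G\<close>.\<close>

lemma eventually_parameters: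
  fixes \<alpha> \<beta> C :: real
  assumes ab: "0 < \<beta>" "\<beta> < \<alpha>" "\<alpha> < 1" "1 < \<alpha> + \<beta>" and C: "0 < C"
  shows "\<forall>\<^sub>F n in sequentially. \<exists>d m G s j. good_parameters \<alpha> \<beta> C n d m G s j"
proof -
  have ab': "\<beta> < 1" "0 < \<alpha>" "1 - \<beta> < \<alpha>" using ab by auto
  have "\<forall>\<^sub>F x in at_top. 800 * (x powr \<alpha> + 3) + 500 * (log 2 x + 1) \<le> x"
    "\<forall>\<^sub>F x in at_top. (x powr (1 - \<beta>) + 1) * (log 2 x + 1) \<le> x powr \<alpha>"
    "\<forall>\<^sub>F x in at_top. 100 * (log 2 x + 1) \<le> x powr \<beta>"
    "\<forall>\<^sub>F x in at_top. 50 * x powr \<beta> + 1200 * (log 2 x + 1) \<le> 12 * x"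
    "\<forall>\<^sub>F x in at_top. (x powr (1 - \<beta>) + 2) * (log 2 x + 1) < 0.26 * x"
    "\<forall>\<^sub>F x in at_top. 16 * (x powr (1 - \<beta>) + 1) \<le> x - 1"
    "\<forall>\<^sub>F x in at_top. 16 * C * (x powr (1 - \<beta>) + 1) \<le> 2 powr (x powr \<beta> / 2)"
    "\<forall>\<^sub>F x in at_top. 16 * x * (x powr (1 - \<beta>) + 1) \<le> 2 powr (0.76 * x)"
    "\<forall>\<^sub>F x in at_top. 3 * x powr \<alpha> + 2 * log 2 x + 11 \<le> 0.76 * x"
    "\<forall>\<^sub>F x in at_top. log 2 x + 7 \<le> 2 * x powr \<alpha>"
    "\<forall>\<^sub>F x in at_top. 4 \<le> (x::real)"
    using ab ab' C by real_asymp+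
  then have ev: "\<forall>\<^sub>F x in at_top. 4 \<le> x \<and>
    800 * (x powr \<alpha> + 3) + 500 * (log 2 x + 1) \<le> x \<and>
    (x powr (1 - \<beta>) + 1) * (log 2 x + 1) \<le> x powr \<alpha> \<and>
    100 * (log 2 x + 1) \<le> x powr \<beta> \<and>
    50 * x powr \<beta> + 1200 * (log 2 x + 1) \<le> 12 * x \<and>
    (x powr (1 - \<beta>) + 2) * (log 2 x + 1) < 0.26 * x \<and>
    16 * (x powr (1 - \<beta>) + 1) \<le> x - 1 \<and>
    16 * C * (x powr (1 - \<beta>) + 1) \<le> 2 powr (x powr \<beta> / 2) \<and>
    16 * x * (x powr (1 - \<beta>) + 1) \<le> 2 powr (0.76 * x) \<and>
    3 * x powr \<alpha> + 2 * log 2 x + 11 \<le> 0.76 * x \<and>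
    log 2 x + 7 \<le> 2 * x powr \<alpha>"
    by eventually_elim blast
  have "filterlim (\<lambda>n. log 2 (real n)) at_top sequentially" by real_asymp
  from eventually_compose_filterlim[OF ev this] eventually_gt_at_top[of 0]
  show ?thesis
    by eventually_elim (intro ex_parameters[OF refl _ _ C], blast+)
qed

lemma exponent_bounds:
  fixes \<epsilon> :: real
  assumes "0 < \<epsilon>" "\<epsilon> < 1 / 2"
  defines "\<alpha> \<equiv> log 2 5 / (log 2 5 + 1 - \<epsilon>)" and "\<beta> \<equiv> (log 2 5 - 0.5 * \<epsilon>) / (log 2 5 + 1 - \<epsilon>)"
  shows "0 < \<beta>" "\<beta> < \<alpha>" "\<alpha> < 1" "1 < \<alpha> + \<beta>"
proof -
  have l: "2 \<le> log 2 (5::real)" by (subst le_log_iff) auto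
  have p: "0 < log 2 5 + 1 - \<epsilon>" using assms(2) l by linarith
  have sum: "\<alpha> + \<beta> = (2 * log 2 5 - 0.5 * \<epsilon>) / (log 2 5 + 1 - \<epsilon>)"
    unfolding \<alpha>_def \<beta>_def by (simp flip: add_divide_distrib)
  show "0 < \<beta>" unfolding \<beta>_def using assms(2) l p by (intro divide_pos_pos) auto
  show "\<beta> < \<alpha>" unfolding \<alpha>_def \<beta>_def using assms(1) p by (intro divide_strict_right_mono) auto
  show "\<alpha> < 1" unfolding \<alpha>_def using assms(2) p by (simp add: pos_divide_less_eq)
  show "1 < \<alpha> + \<beta>" unfolding sum using assms(1) l p by (simp add: pos_less_divide_eq)
qed

theorem theorem3p1:
  shows "\<exists>\<epsilon>0>0. \<forall>\<epsilon>::real. 0 < \<epsilon> \<and> \<epsilon> < \<epsilon>0 \<longrightarrow>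
    (let \<alpha> = log 2 5 / (log 2 5 + 1 - \<epsilon>);
         \<beta> = (log 2 5 - 0.5 * \<epsilon>) / (log 2 5 + 1 - \<epsilon>)
     in \<forall>CF>0. \<exists>c1>0. \<exists>C2. \<exists>N::nat. \<forall>n\<ge>N.
        \<exists>(E::nat set) (ends::nat \<Rightarrow> nat \<times> nat) (cap::nat \<Rightarrow> real) (T::nat set).
          simple_cap_graph {0..<n} E ends cap \<and> T \<subseteq> {0..<n} \<and>
          card T = nat \<lfloor>real n / 2 powr (log 2 (real n) powr \<alpha>)\<rfloor> \<and>
          (\<forall>F. valid_partition {0..<n} T F \<and>
                real (card F) \<le> CF * real n / 2 powr (log 2 (real n) powr \<beta>) \<longrightarrow>
             (\<exists>D. is_demand T D \<and>
                cong {0..<n} E ends cap id T D \<ge> ereal (c1 * log 2 (real n) powr (1 - \<alpha>)) \<and>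
                cong F (contr_edges F E ends) (contr_ends F ends) cap (part F) T D \<le> ereal C2)))"
proof (intro exI[of _ "1/2"] conjI allI impI)
  show "(0::real) < 1/2" by simp
  fix \<epsilon> :: real assume \<epsilon>: "0 < \<epsilon> \<and> \<epsilon> < 1/2"
  define \<alpha> where "\<alpha> = log 2 5 / (log 2 5 + 1 - \<epsilon>)"
  define \<beta> where "\<beta> = (log 2 5 - 0.5 * \<epsilon>) / (log 2 5 + 1 - \<epsilon>)"
  have ab: "0 < \<beta>" "\<beta> < \<alpha>" "\<alpha> < 1" "1 < \<alpha> + \<beta>"
    using exponent_bounds[of \<epsilon>] \<epsilon> by (auto simp: \<alpha>_def \<beta>_def)
  have "\<exists>c1>0. \<exists>C2. \<exists>N::nat. \<forall>n\<ge>N.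
        \<exists>(E::nat set) (ends::nat \<Rightarrow> nat \<times> nat) (cap::nat \<Rightarrow> real) (T::nat set).
          simple_cap_graph {0..<n} E ends cap \<and> T \<subseteq> {0..<n} \<and>
          card T = nat \<lfloor>real n / 2 powr (log 2 (real n) powr \<alpha>)\<rfloor> \<and>
          (\<forall>F. valid_partition {0..<n} T F \<and>
                real (card F) \<le> CF * real n / 2 powr (log 2 (real n) powr \<beta>) \<longrightarrow>
             (\<exists>D. is_demand T D \<and>
                cong {0..<n} E ends cap id T D \<ge> ereal (c1 * log 2 (real n) powr (1 - \<alpha>)) \<and>
                cong F (contr_edges F E ends) (contr_ends F ends) cap (part F) T D \<le> ereal C2))"
    if CF: "0 < CF" for CF :: real
  proof -
    obtain N where N: "\<forall>n\<ge>N. \<exists>d m G s j. good_parameters \<alpha> \<beta> CF n d m G s j"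
      using eventually_parameters[OF ab CF] unfolding eventually_sequentially by blast
    show ?thesis
    \<comment> \<open>The lower constant is that of \<open>good_parameters\<close>; the upper
      constant 2 is the load bound in \<open>packing_covering_alternative\<close>.\<close>
    proof (rule exI[of _ "1 / 76800"], rule conjI, simp, rule exI[of _ 2], rule exI[of _ N], intro allI impI)
      fix n assume "N \<le> n"
      with N obtain d m G s j where good: "good_parameters \<alpha> \<beta> CF n d m G s j" by blast
      have d2: "2 \<le> d" and m0: "0 < m" and Gm: "4 * m \<le> G" and jm: "j \<le> m"
        and j0: "0 < j" and s0: "0 < s" "s \<le> 12 * G" and sj: "2 * (12 * G + 1) < s * j"
        and gap: "log 2 (real n) powr (1 - \<alpha>) / 76800 \<le> real G / (96 * real m)"
        using good by (simp_all add: good_parameters_def)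
      have few: "2 * j * (\<phi> * ((d + 1) ^ s + 1) * d + 2 * n + D * d) < n * d"
        if "real \<phi> \<le> CF * n / 2 powr (log 2 (real n) powr \<beta>)" "D \<le> (d + 1) ^ (2 * (12 * G) + 1)" for \<phi> D
        using good that unfolding good_parameters_def by (elim conjE) simp
      have size: "k + D * (d + 1) ^ m \<le> nat \<lfloor>real n / 2 powr (log 2 (real n) powr \<alpha>)\<rfloor>"
        if "k * (d - 1) ^ m \<le> n" "D \<le> (d + 1) ^ (2 * (12 * G) + 1)" for k D
        using good that unfolding good_parameters_def by (elim conjE) simp
      define r where "r = 12 * G"
      obtain R where R: "R \<subseteq> {0..<n} \<times> {0..<n}" "sym R" "irrefl R" "\<And>u. card (R `` {u}) \<le> d"
        "girth_above R (2 * r + 1)"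
        and close: "\<And>u v. u < n \<Longrightarrow> v < n \<Longrightarrow> card (R `` {u}) < d \<Longrightarrow> card (R `` {v}) < d \<Longrightarrow>
          \<exists>k\<le>2 * r + 1. (u, v) \<in> R ^^ k"
        using ex_maximal_girth_graph[of "2 * r + 1" n d] by auto
      interpret high_girth_graph n d r R
        using R by unfold_locales
      have cdef: "card deficient \<le> (d + 1) ^ (2 * (12 * G) + 1)"
        using card_deficient[OF close] by (simp add: r_def)
      have "2 * m \<le> r" using Gm by (simp add: r_def)
      then obtain S k where S: "S \<subseteq> {0..<n}" "\<And>v. v < n \<Longrightarrow> \<exists>s\<in>S. dd v s \<le> 2 * m"
        and k: "k * (d - 1) ^ m \<le> n" "card S \<le> k + card deficient * (d + 1) ^ m"
        using ex_dominating_set[of m] by metis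
      \<comment> \<open>The net may be smaller than the prescribed number of terminals. Padding it
        to exactly \<open>K\<close> vertices keeps it a net.\<close>
      define K where "K = nat \<lfloor>real n / 2 powr (log 2 (real n) powr \<alpha>)\<rfloor>"
      have SK: "card S \<le> K" using k(2) size[OF k(1) cdef] unfolding K_def by linarith
      have Kn: "K \<le> card {0..<n}"
      proof -
        have "real n / 2 powr (log 2 (real n) powr \<alpha>) \<le> real n / 1"
          by (intro divide_left_mono) (auto simp: ge_one_powr_ge_zero)
        then show ?thesis unfolding K_def by simp linarith
      qed
      obtain T where T': "S \<subseteq> T" "T \<subseteq> {0..<n}" "card T = K"
        using exists_subset_between[OF SK Kn S(1)] by auto
      \<comment> \<open>A terminal must be its own terminal, even one that was only added as
        padding; every other vertex goes to the original net.\<close>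
      define t where "t v = (if v \<in> T then v else SOME s. s \<in> S \<and> dd v s \<le> 2 * m)" for v
      have t: "t v \<in> T \<and> dd v (t v) \<le> 2 * m" if "v < n" for v
        using S(2)[OF that] T'(1) someI_ex[of "\<lambda>s. s \<in> S \<and> dd v s \<le> 2 * m"] by (auto simp: t_def)
      interpret attached_graph n d r R T t m
        using T'(2) t m0 d2 by unfold_locales (auto simp: t_def)
      have bad: "\<exists>D. is_demand T D \<and>
          cong {0..<n} (XE \<union> AE) prod_decode cap id T D \<ge> ereal (1 / 76800 * log 2 (real n) powr (1 - \<alpha>)) \<and>
          cong F (contr_edges F (XE \<union> AE) prod_decode) (contr_ends F prod_decode) cap (part F) T D \<le> ereal 2"
        if F: "valid_partition {0..<n} T F" "real (card F) \<le> CF * real n / 2 powr (log 2 (real n) powr \<beta>)" for F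
      proof -
        obtain D where D: "is_demand T D" "ereal (real G / (96 * real m)) \<le> cong {0..<n} (XE \<union> AE) prod_decode cap id T D"
          "cong F (contr_edges F (XE \<union> AE) prod_decode) (contr_ends F prod_decode) cap (part F) T D \<le> ereal 2"
          using ex_bad_demand[OF F(1) Gm jm j0 r_def s0(1) s0(2)[folded r_def] sj[folded r_def] few[OF F(2) cdef]]
          by blast
        have "ereal (1 / 76800 * log 2 (real n) powr (1 - \<alpha>)) \<le> ereal (real G / (96 * real m))" using gap by simp
        then show ?thesis using D order_trans by blast
      qed
      show "\<exists>(E::nat set) (ends::nat \<Rightarrow> nat \<times> nat) (cap::nat \<Rightarrow> real) (T::nat set).
          simple_cap_graph {0..<n} E ends cap \<and> T \<subseteq> {0..<n} \<and>
          card T = nat \<lfloor>real n / 2 powr (log 2 (real n) powr \<alpha>)\<rfloor> \<and>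
          (\<forall>F. valid_partition {0..<n} T F \<and>
                real (card F) \<le> CF * real n / 2 powr (log 2 (real n) powr \<beta>) \<longrightarrow>
             (\<exists>D. is_demand T D \<and>
                cong {0..<n} E ends cap id T D \<ge> ereal (1 / 76800 * log 2 (real n) powr (1 - \<alpha>)) \<and>
                cong F (contr_edges F E ends) (contr_ends F ends) cap (part F) T D \<le> ereal 2))"
        using simple T'(2) T'(3)[unfolded K_def]
        by (intro exI[of _ "XE \<union> AE"] exI[of _ prod_decode] exI[of _ cap] exI[of _ T] conjI allI impI)
          (assumption | elim conjE, rule bad)+
    qed
  qed
  then show "let \<alpha> = log 2 5 / (log 2 5 + 1 - \<epsilon>);
         \<beta> = (log 2 5 - 0.5 * \<epsilon>) / (log 2 5 + 1 - \<epsilon>)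
     in \<forall>CF>0. \<exists>c1>0. \<exists>C2. \<exists>N::nat. \<forall>n\<ge>N.
        \<exists>(E::nat set) (ends::nat \<Rightarrow> nat \<times> nat) (cap::nat \<Rightarrow> real) (T::nat set).
          simple_cap_graph {0..<n} E ends cap \<and> T \<subseteq> {0..<n} \<and>
          card T = nat \<lfloor>real n / 2 powr (log 2 (real n) powr \<alpha>)\<rfloor> \<and>
          (\<forall>F. valid_partition {0..<n} T F \<and>
                real (card F) \<le> CF * real n / 2 powr (log 2 (real n) powr \<beta>) \<longrightarrow>
             (\<exists>D. is_demand T D \<and>
                cong {0..<n} E ends cap id T D \<ge> ereal (c1 * log 2 (real n) powr (1 - \<alpha>)) \<and>
                cong F (contr_edges F E ends) (contr_ends F ends) cap (part F) T D \<le> ereal C2))"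
    unfolding Let_def \<alpha>_def \<beta>_def by blast
qed

end
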